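(* Let $a\in C^\infty[0,T]$. (1) Suppose $JM_a=\sum_{\gamma\in F}M_{b_\gamma}D^\gamma+V_K$ as operators on $\mathcal M$, where $F\subset\mathbb R$ is finite, $b_\gamma\in C^\infty[0,T]$, and $K$ is smooth on $\Delta_T$ and flat to every order in $t-s$ along the diagonal. Then $b_\gamma=0$ for every $\gamma\in F$ that is not a negative integer. (2) Suppose that for some $N<\infty$ and $b_0,\dots,b_N\in C^\infty[0,T]$ one has $$JM_a=\sum_{j=0}^{N}M_{b_j}J^{j+1}+V_K$$ as operators on $\mathcal M$, where $K$ is smooth on $\Delta_T$ and flat to every order in $t-s$ along the diagonal. Then $b_j=(-1)^ja^{(j)}$ for $0\le j\le N$ and $a^{(j)}=0$ for every $j>N$; hence $a$ is a polynomial of degree at most $N$. (3) Conversely, for every polynomial $a$ an identity as in (2) holds with $K=0$ for some finite $N$. Thus the polynomial multipliers are exactly the smooth multipliers that reorder finitely with $J$ modulo a smooth diagonal-flat remainder.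
   Context: Fix $T>0$; functions are complex-valued. Let $\mathcal M=\{f\in C^\infty[0,T]: f^{(n)}(0)=0\text{ for all }n\ge 0\}$. For $\mu>0$ put $(J^\mu f)(t)=\frac1{\Gamma(\mu)}\int_0^t(t-s)^{\mu-1}f(s)\,ds$ and $J=J^1$. On $\mathcal M$ define $D^{-\mu}=J^\mu$ for $\mu>0$, $D^0=I$, and for $\alpha>0$, $D^\alpha f=J^{n-\alpha}f^{(n)}$ for any integer $n>\alpha$. For a smooth function $b$, $M_b$ is multiplication by $b$. $\Delta_T=\{(t,s):0\le s\le t\le T\}$ and $(V_Kf)(t)=\int_0^tK(t,s)f(s)\,ds$. "Flat to every order in $t-s$ along the diagonal" means that for each $t$ all derivatives of $u\mapsto K(t,t-u)$ vanish at $u=0$. *)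

theory Defs
  imports
    "HOL-Analysis.Analysis"
    "HOL-Computational_Algebra.Polynomial"
begin

(* Smoothness on a possibly non-open set S: all derivatives are taken within S, i.e. they are
   one-sided at the boundary.  It is used for S = {0..T} and for the closed triangle Delta_T, both
   convex with nonempty interior when T > 0, so derivatives within S are unique.  Only the values
   of the function on S matter. *)
fun Ck_on :: "nat \<Rightarrow> 'a::real_normed_vector set \<Rightarrow> ('a \<Rightarrow> 'b::real_normed_vector) \<Rightarrow> bool" where
  "Ck_on 0 S f \<longleftrightarrow> continuous_on S f"
| "Ck_on (Suc k) S f \<longleftrightarrow>
     (\<forall>x\<in>S. f differentiable (at x within S)) \<and>
     (\<forall>v. Ck_on k S (\<lambda>x. frechet_derivative f (at x within S) v))"

definition smooth_on :: "'a::real_normed_vector set \<Rightarrow> ('a \<Rightarrow> 'b::real_normed_vector) \<Rightarrow> bool" where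
  "smooth_on S f \<longleftrightarrow> (\<forall>k. Ck_on k S f)"

fun iter_deriv :: "real set \<Rightarrow> nat \<Rightarrow> (real \<Rightarrow> complex) \<Rightarrow> real \<Rightarrow> complex" where
  "iter_deriv S 0 f = f"
| "iter_deriv S (Suc n) f = (\<lambda>t. vector_derivative (iter_deriv S n f) (at t within S))"

definition flat_at_zero :: "real \<Rightarrow> (real \<Rightarrow> complex) set" where
  "flat_at_zero T = {f. smooth_on {0..T} f \<and> (\<forall>n. iter_deriv {0..T} n f 0 = 0)}"

(* Meant for \<mu> > 0; J = J^1 is frac_int 1.  (The convention 0 powr 0 = 0 only affects
   the integrand at s = t.) *)
definition frac_int :: "real \<Rightarrow> (real \<Rightarrow> complex) \<Rightarrow> real \<Rightarrow> complex" where
  "frac_int \<mu> f t =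
     complex_of_real (1 / Gamma \<mu>) *
     integral {0..t} (\<lambda>s. complex_of_real ((t - s) powr (\<mu> - 1)) * f s)"

(* D^\<alpha> on flat_at_zero T.  For \<alpha> > 0 the least integer n > \<alpha> is used; every other integer
   n > \<alpha> gives the same operator, see frac_op_eq below. *)
definition frac_op :: "real \<Rightarrow> real \<Rightarrow> (real \<Rightarrow> complex) \<Rightarrow> real \<Rightarrow> complex" where
  "frac_op T \<alpha> f =
     (if \<alpha> < 0 then frac_int (- \<alpha>) f
      else if \<alpha> = 0 then f
      else let n = nat (\<lfloor>\<alpha>\<rfloor> + 1) in frac_int (real n - \<alpha>) (iter_deriv {0..T} n f))"

definition triangle :: "real \<Rightarrow> (real \<times> real) set" where
  "triangle T = {(t, s). 0 \<le> s \<and> s \<le> t \<and> t \<le> T}"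

definition volterra :: "(real \<times> real \<Rightarrow> complex) \<Rightarrow> (real \<Rightarrow> complex) \<Rightarrow> real \<Rightarrow> complex" where
  "volterra K f t = integral {0..t} (\<lambda>s. K (t, s) * f s)"

(* For t = 0 the function u \<mapsto> K (t, t - u) lives on a single point and has no derivatives; for K
   smooth on the triangle the condition there follows from t > 0 by continuity. *)
definition diagonal_flat :: "real \<Rightarrow> (real \<times> real \<Rightarrow> complex) \<Rightarrow> bool" where
  "diagonal_flat T K \<longleftrightarrow>
     (\<forall>t\<in>{0<..T}. \<forall>n. iter_deriv {0..t} n (\<lambda>u. K (t, t - u)) 0 = 0)"

definition flat_kernel :: "real \<Rightarrow> (real \<times> real \<Rightarrow> complex) \<Rightarrow> bool" where
  "flat_kernel T K \<longleftrightarrow> smooth_on (triangle T) K \<and> diagonal_flat T K"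

(* J M_a = (SUM j=0..N. M_{b_j} J^(j+1)) + V_K as operators on flat_at_zero T *)
definition reorder_identity ::
  "real \<Rightarrow> (real \<Rightarrow> complex) \<Rightarrow> nat \<Rightarrow> (nat \<Rightarrow> real \<Rightarrow> complex) \<Rightarrow> (real \<times> real \<Rightarrow> complex) \<Rightarrow> bool" where
  "reorder_identity T a N b K \<longleftrightarrow>
     (\<forall>f\<in>flat_at_zero T. \<forall>t\<in>{0..T}.
        frac_int 1 (\<lambda>s. a s * f s) t =
        (\<Sum>j=0..N. b j t * frac_int (real (j + 1)) f t) + volterra K f t)"

definition finitely_reorders :: "real \<Rightarrow> (real \<Rightarrow> complex) \<Rightarrow> bool" where
  "finitely_reorders T a \<longleftrightarrow>
     (\<exists>N b K. (\<forall>j\<le>N. smooth_on {0..T} (b j)) \<and> flat_kernel T K \<and> reorder_identity T a N b K)"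


lemma Ck_on_cong:
  assumes "Ck_on k S f" and "\<And>x. x \<in> S \<Longrightarrow> f x = g x"
  shows "Ck_on k S g"
  using assms
proof (induction k arbitrary: f g)
  case 0
  then show ?case using continuous_on_cong by force
next
  case (Suc k)
  have eq: "(f has_derivative D) (at x within S) \<longleftrightarrow> (g has_derivative D) (at x within S)"
    if "x \<in> S" for x D
    using Suc.prems(2) that by (metis has_derivative_transform)
  have "g differentiable (at x within S)" if "x \<in> S" for x
  proof -
    have "f differentiable (at x within S)" using Suc.prems(1) that by simp
    then show ?thesis unfolding differentiable_def eq[OF that] .
  qed
  moreover have "frechet_derivative f (at x within S) = frechet_derivative g (at x within S)"
    if "x \<in> S" for x
    unfolding frechet_derivative_def eq[OF that] ..
  ultimately show ?case
    using Suc.prems(1) by (auto intro: Suc.IH)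
qed

lemma smooth_on_imp_continuous_on: "smooth_on S f \<Longrightarrow> continuous_on S f"
  unfolding smooth_on_def by (metis Ck_on.simps(1))

lemma smooth_on_has_vector_derivative:
  assumes "smooth_on S f" "x \<in> S"
  shows "(f has_vector_derivative vector_derivative f (at x within S)) (at x within S)"
proof -
  have "Ck_on (Suc 0) S f"
    using assms unfolding smooth_on_def by blast
  then show ?thesis
    using assms(2) by (simp add: vector_derivative_works[symmetric])
qed

lemma smooth_on_vector_derivative:
  fixes f :: "real \<Rightarrow> complex"
  assumes "smooth_on {a..b} f" "a < b"
  shows "smooth_on {a..b} (\<lambda>x. vector_derivative f (at x within {a..b}))"
  unfolding smooth_on_def
proof
  fix k
  have C: "Ck_on (Suc k) {a..b} f"
    using assms unfolding smooth_on_def by blast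
  have "frechet_derivative f (at x within {a..b}) 1 = vector_derivative f (at x within {a..b})"
    if x: "x \<in> {a..b}" for x
  proof -
    let ?F = "frechet_derivative f (at x within {a..b})"
    have d: "(f has_derivative ?F) (at x within {a..b})"
      using C x by (simp add: frechet_derivative_works[symmetric])
    then have "?F = (\<lambda>h. h *\<^sub>R ?F 1)"
      by (metis (no_types, opaque_lifting) bounded_linear.linear has_derivative_bounded_linear
          linear_cmul mult.right_neutral real_scaleR_def)
    then have "(f has_vector_derivative ?F 1) (at x within {a..b})"
      using d unfolding has_vector_derivative_def by simp
    then show ?thesis
      using vector_derivative_within_closed_interval[OF assms(2) x] by metis
  qed
  then show "Ck_on k {a..b} (\<lambda>x. vector_derivative f (at x within {a..b}))"
    using C by (auto intro: Ck_on_cong[of k _ "\<lambda>x. frechet_derivative f (at x within {a..b}) 1"])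
qed

lemma smooth_on_iter_deriv:
  "smooth_on {a..b} f \<Longrightarrow> a < b \<Longrightarrow> smooth_on {a..b} (iter_deriv {a..b} n f)"
  by (induction n) (auto intro: smooth_on_vector_derivative)

lemma frac_int_deriv:
  assumes T: "T > 0" and \<mu>: "\<mu> > 0" and f: "smooth_on {0..T} f" and f0: "f 0 = 0"
    and t: "t \<in> {0..T}"
  shows "frac_int (\<mu> + 1) (\<lambda>s. vector_derivative f (at s within {0..T})) t = frac_int \<mu> f t"
proof -
  define f' where "f' = (\<lambda>s. vector_derivative f (at s within {0..T}))"
  have sub: "{0..t} \<subseteq> {0..T}" using t by auto
  have contf: "continuous_on {0..t} f" and contf': "continuous_on {0..t} f'"
    using f smooth_on_vector_derivative[OF f T] sub unfolding f'_def
    by (auto intro: continuous_on_subset smooth_on_imp_continuous_on)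
  have contp: "continuous_on {0..t} (\<lambda>s. complex_of_real ((t - s) powr \<mu>))"
    using \<mu> by (intro continuous_intros continuous_on_powr') auto
  let ?G = "\<lambda>s. complex_of_real ((t - s) powr \<mu>) * f s"
  let ?A = "\<lambda>s. complex_of_real ((t - s) powr \<mu>) * f' s"
  let ?B = "\<lambda>s. complex_of_real ((t - s) powr (\<mu> - 1)) * f s"
  have "((\<lambda>s. ?A s - of_real \<mu> * ?B s) has_integral (?G t - ?G 0)) {0..t}"
  proof (rule fundamental_theorem_of_calculus_interior)
    show "0 \<le> t" using t by simp
    show "continuous_on {0..t} ?G"
      using contp contf by (rule continuous_on_mult)
    fix s assume s: "s \<in> {0<..<t}"
    have "(f has_vector_derivative f' s) (at s within {0..T})"
      unfolding f'_def using s t by (intro smooth_on_has_vector_derivative[OF f]) auto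
    moreover have "at s within {0..T} = at s"
      using s t by (intro at_within_interior) auto
    ultimately have d1: "(f has_vector_derivative f' s) (at s)" by simp
    have "((\<lambda>s. (t - s) powr \<mu>) has_real_derivative - (\<mu> * (t - s) powr (\<mu> - 1))) (at s)"
      using s by (auto intro!: derivative_eq_intros)
    then have d2: "((\<lambda>s. complex_of_real ((t - s) powr \<mu>)) has_vector_derivative
        complex_of_real (- (\<mu> * (t - s) powr (\<mu> - 1)))) (at s)"
      by (intro has_vector_derivative_of_real)
        (simp add: has_real_derivative_iff_has_vector_derivative)
    show "(?G has_vector_derivative ?A s - of_real \<mu> * ?B s) (at s)"
      using has_vector_derivative_mult[OF d2 d1] by (simp add: algebra_simps)
  qed
  then have I: "((\<lambda>s. ?A s - of_real \<mu> * ?B s) has_integral 0) {0..t}"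
    using \<mu> f0 by simp
  have "?A integrable_on {0..t}"
    using contp contf' by (intro integrable_continuous_interval continuous_on_mult)
  then have A: "(?A has_integral integral {0..t} ?A) {0..t}"
    by (rule integrable_integral)
  have "((\<lambda>s. of_real \<mu> * ?B s) has_integral integral {0..t} ?A) {0..t}"
    using has_integral_diff[OF A I] by simp
  then have "((\<lambda>s. inverse (of_real \<mu>) * (of_real \<mu> * ?B s)) has_integral
      inverse (of_real \<mu>) * integral {0..t} ?A) {0..t}"
    by (rule has_integral_mult_right)
  then have "(?B has_integral inverse (of_real \<mu>) * integral {0..t} ?A) {0..t}"
    using \<mu> by (simp add: mult.assoc[symmetric])
  then have B: "integral {0..t} ?B = inverse (of_real \<mu>) * integral {0..t} ?A"
    by (rule integral_unique)
  have "Gamma (\<mu> + 1) = \<mu> * Gamma \<mu>"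
    using \<mu> by (intro Gamma_plus1) (auto elim!: nonpos_Ints_cases)
  then show ?thesis
    unfolding frac_int_def B f'_def[symmetric] by (simp add: field_simps)
qed

lemma frac_op_eq:
  assumes T: "T > 0" and f: "f \<in> flat_at_zero T" and "\<alpha> > 0" and n: "real n > \<alpha>"
    and t: "t \<in> {0..T}"
  shows "frac_op T \<alpha> f t = frac_int (real n - \<alpha>) (iter_deriv {0..T} n f) t"
proof -
  define m where "m = nat (\<lfloor>\<alpha>\<rfloor> + 1)"
  have m: "real m > \<alpha>" using \<open>\<alpha> > 0\<close> unfolding m_def by linarith
  have "m \<le> n" using n \<open>\<alpha> > 0\<close> unfolding m_def by linarith
  then have "frac_int (real n - \<alpha>) (iter_deriv {0..T} n f) t =
      frac_int (real m - \<alpha>) (iter_deriv {0..T} m f) t"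
  proof (induction n rule: dec_induct)
    case base
    show ?case ..
  next
    case (step k)
    have "frac_int ((real k - \<alpha>) + 1) (iter_deriv {0..T} (Suc k) f) t =
        frac_int (real k - \<alpha>) (iter_deriv {0..T} k f) t"
      unfolding iter_deriv.simps
      using f m step.hyps T t
      by (intro frac_int_deriv) (auto simp: flat_at_zero_def intro: smooth_on_iter_deriv)
    then show ?case using step.IH by (simp add: algebra_simps)
  qed
  then show ?thesis
    using \<open>\<alpha> > 0\<close> unfolding frac_op_def m_def Let_def by simp
qed

end

theory Submission
  imports Defs
begin

text \<open>
  Fix $t > 0$. An identity $J M_a = \sum_\gamma M_{b_\gamma} D^\gamma + V_K$, evaluated at $t$, says
  that two functionals of $f$ agree on all flat functions. A flat $f$ is an iterated integral
  $J^n g$ of the flat function $g = f^{(n)}$, and for $n$ large every $D^\gamma f(t)$ becomes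
  $J^{n-\gamma} g(t)$, a convolution of $g$ with $u^{n-\gamma-1} / \Gamma(n-\gamma)$. This treats
  integral, fractional and differential terms alike (\<open>frac_op_flat_seq\<close>). The remaining terms
  $J(af)(t) - V_K f(t)$ become, by $n$ integrations by parts, the convolution of $g$ with the
  $n$-fold antiderivative $E$ of $e(u) = a(t-u) - K(t, t-u)$.

  The functions $s^m e^{-1/s}$ are flat and, by Weierstrass' theorem, numerous enough to separate
  continuous kernels (\<open>orthogonal_to_flat_imp_zero\<close>). Hence
  $E(u) = \sum_\gamma b_\gamma(t) u^{n-\gamma-1} / \Gamma(n-\gamma)$. Now $E$ is smooth up to
  $u = 0$, vanishes there to order $n$, and its derivative of order $n + j$ at 0 is that of order
  $j$ of $u \mapsto a(t-u)$, because $K$ is flat along the diagonal. Expansions in finitely many real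
  powers are unique (\<open>real_power_expansion_unique\<close>); so the coefficients $b_\gamma(t)$ vanish unless
  $\gamma = -(j+1)$ is a negative integer, where $b_\gamma(t) = (-1)^j a^{(j)}(t)$, and
  $a^{(j)}(t) = 0$ when $-(j+1)$ does not occur in the sum (\<open>coefficients_of_convolution\<close>). If only
  finitely many powers of $J$ occur, some derivative of $a$ vanishes identically and $a$ is its
  Taylor polynomial. Conversely the finite Taylor expansion of a polynomial $a(s)$ around $t$ is a
  reordering identity without remainder (\<open>poly_reorder_identity\<close>).
\<close>

section \<open>Sequences of successive derivatives\<close>

text \<open>Smoothness is handled through the whole sequence of successive derivatives. A sequence that is
  differentiated by shifting its index can be shifted, reflected, integrated and multiplied by the
  variable by explicit formulas, so smoothness and all values of derivatives at the endpoint 0 are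
  obtained together.\<close>
definition deriv_seq :: "real set \<Rightarrow> (nat \<Rightarrow> real \<Rightarrow> complex) \<Rightarrow> bool" where
  "deriv_seq S \<phi> \<longleftrightarrow>
     (\<forall>k. \<forall>x\<in>S. (\<phi> k has_vector_derivative \<phi> (Suc k) x) (at x within S))"

lemma deriv_seq_continuous_on: "deriv_seq S \<phi> \<Longrightarrow> continuous_on S (\<phi> k)"
  unfolding deriv_seq_def
  by (meson continuous_on_eq_continuous_within has_vector_derivative_continuous)

lemma deriv_seq_subset: "deriv_seq S \<phi> \<Longrightarrow> R \<subseteq> S \<Longrightarrow> deriv_seq R \<phi>"
  unfolding deriv_seq_def by (meson has_vector_derivative_within_subset subsetD)

lemma deriv_seq_at:
  assumes "deriv_seq {a..b} \<phi>" "x \<in> {a<..<b}"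
  shows "(\<phi> k has_vector_derivative \<phi> (Suc k) x) (at x)"
proof -
  have "at x within {a..b} = at x"
    using assms(2) by (intro at_within_interior) auto
  then show ?thesis
    using assms unfolding deriv_seq_def by (metis greaterThanLessThan_subseteq_atLeastAtMost_iff
        order_refl subsetD)
qed

lemma deriv_seq_tail: "deriv_seq S \<phi> \<Longrightarrow> deriv_seq S (\<lambda>k. \<phi> (n + k))"
  unfolding deriv_seq_def by simp

text \<open>In one variable the Frechet derivative within a nondegenerate interval is unique, also at the
  endpoints; this identifies the arbitrary choice in \<^const>\<open>frechet_derivative\<close>.\<close>
lemma frechet_derivative_interval:
  assumes "a < b" "x \<in> {a..b}" "(f has_vector_derivative d) (at x within {a..b})"
  shows "frechet_derivative f (at x within {a..b}) v = v *\<^sub>R d"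
proof -
  let ?D = "frechet_derivative f (at x within {a..b})"
  have D: "(f has_derivative ?D) (at x within {a..b})"
    using assms(3) frechet_derivative_works has_vector_derivative_def differentiable_def by blast
  then have lin: "?D w = w *\<^sub>R ?D 1" for w
    by (metis has_derivative_bounded_linear bounded_linear.linear linear_cmul mult.right_neutral
        real_scaleR_def)
  then have "(f has_vector_derivative ?D 1) (at x within {a..b})"
    using D unfolding has_vector_derivative_def by (metis (no_types, lifting) ext)
  then have "?D 1 = d"
    using assms by (metis vector_derivative_unique_within_closed_interval box_real(2))
  then show ?thesis using lin by metis
qed

lemma Ck_on_scaleR:
  assumes "Ck_on k {a..b} f" "a < b"
  shows "Ck_on k {a..b} (\<lambda>x::real. c *\<^sub>R f x)"
  using assms(1)
proof (induction k arbitrary: f)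
  case 0
  then show ?case by (simp add: continuous_on_scaleR)
next
  case (Suc k)
  have d: "(f has_vector_derivative frechet_derivative f (at x within {a..b}) 1) (at x within {a..b})"
    if "x \<in> {a..b}" for x
  proof -
    have "f differentiable (at x within {a..b})" using Suc.prems that by simp
    then obtain d where d: "(f has_vector_derivative d) (at x within {a..b})"
      using vector_derivative_works by blast
    then show ?thesis
      using frechet_derivative_interval[of a b x f d 1] that assms(2) by simp
  qed
  have d': "((\<lambda>x. c *\<^sub>R f x) has_vector_derivative c *\<^sub>R frechet_derivative f (at x within {a..b}) 1)
      (at x within {a..b})" if "x \<in> {a..b}" for x
    using d[OF that] by (auto intro!: derivative_eq_intros)
  show ?case
    unfolding Ck_on.simps
  proof (intro conjI ballI allI)
    show "(\<lambda>x. c *\<^sub>R f x) differentiable (at x within {a..b})" if "x \<in> {a..b}" for x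
      using d'[OF that] differentiableI_vector by blast
    fix v
    have "Ck_on k {a..b} (\<lambda>x. c *\<^sub>R frechet_derivative f (at x within {a..b}) v)"
      using Suc by simp
    moreover have "c *\<^sub>R frechet_derivative f (at x within {a..b}) v =
        frechet_derivative (\<lambda>x. c *\<^sub>R f x) (at x within {a..b}) v" if "x \<in> {a..b}" for x
      using frechet_derivative_interval[OF assms(2) that d[OF that], of v]
        frechet_derivative_interval[OF assms(2) that d'[OF that], of v]
      by simp
    ultimately show "Ck_on k {a..b} (\<lambda>x. frechet_derivative (\<lambda>x. c *\<^sub>R f x) (at x within {a..b}) v)"
      by (rule Ck_on_cong)
  qed
qed

lemma deriv_seq_smooth_on:
  assumes "a < b" "deriv_seq {a..b} \<phi>"
  shows "smooth_on {a..b} (\<phi> n)"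
proof -
  have "Ck_on k {a..b} (\<phi> n)" for k
  proof (induction k arbitrary: n)
    case 0
    then show ?case by (simp add: deriv_seq_continuous_on[OF assms(2)])
  next
    case (Suc k)
    have d: "(\<phi> n has_vector_derivative \<phi> (Suc n) x) (at x within {a..b})" if "x \<in> {a..b}" for x
      using assms(2) that unfolding deriv_seq_def by blast
    have "Ck_on k {a..b} (\<lambda>x. frechet_derivative (\<phi> n) (at x within {a..b}) v)" for v
    proof (rule Ck_on_cong)
      show "Ck_on k {a..b} (\<lambda>x. v *\<^sub>R \<phi> (Suc n) x)"
        using Ck_on_scaleR[OF Suc.IH assms(1)] .
      show "v *\<^sub>R \<phi> (Suc n) x = frechet_derivative (\<phi> n) (at x within {a..b}) v"
        if "x \<in> {a..b}" for x
        using frechet_derivative_interval[OF assms(1) that d[OF that]] by simp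
    qed
    moreover have "\<phi> n differentiable (at x within {a..b})" if "x \<in> {a..b}" for x
      using d[OF that] by (rule differentiableI_vector)
    ultimately show ?case by simp
  qed
  then show ?thesis unfolding smooth_on_def by blast
qed

lemma deriv_seq_iter_deriv:
  assumes "a < b" "deriv_seq {a..b} \<phi>" "x \<in> {a..b}"
  shows "iter_deriv {a..b} n (\<phi> 0) x = \<phi> n x"
  using assms(3)
proof (induction n arbitrary: x)
  case (Suc n)
  have "(\<phi> n has_vector_derivative \<phi> (Suc n) x) (at x within {a..b})"
    using assms(2) Suc.prems unfolding deriv_seq_def by blast
  then have "(iter_deriv {a..b} n (\<phi> 0) has_vector_derivative \<phi> (Suc n) x) (at x within {a..b})"
    using has_vector_derivative_transform Suc.IH Suc.prems by metis
  then show ?case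
    using vector_derivative_within_closed_interval[OF assms(1) Suc.prems] by simp
qed simp

lemma smooth_on_deriv_seq:
  assumes "smooth_on {a..b} f" "a < b"
  shows "deriv_seq {a..b} (\<lambda>k. iter_deriv {a..b} k f)"
  unfolding deriv_seq_def
  using smooth_on_has_vector_derivative[OF smooth_on_iter_deriv[OF assms]] by simp

lemma deriv_seq_reflect:
  assumes "deriv_seq {0..t} \<phi>"
  shows "deriv_seq {0..t} (\<lambda>k u. (-1) ^ k * \<phi> k (t - u))"
  unfolding deriv_seq_def
proof (intro allI ballI)
  fix k u assume u: "u \<in> {0..t}"
  have "((\<lambda>u. t - u) has_vector_derivative -1) (at u within {0..t})"
    by (auto intro!: derivative_eq_intros)
  moreover have "(\<phi> k has_vector_derivative \<phi> (Suc k) (t - u)) (at (t - u) within (\<lambda>u. t - u) ` {0..t})"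
    using assms u unfolding deriv_seq_def by auto
  ultimately have "((\<lambda>u. \<phi> k (t - u)) has_vector_derivative - \<phi> (Suc k) (t - u)) (at u within {0..t})"
    using vector_diff_chain_within by (fastforce simp: o_def)
  then show "((\<lambda>u. (-1) ^ k * \<phi> k (t - u)) has_vector_derivative
      (-1) ^ Suc k * \<phi> (Suc k) (t - u)) (at u within {0..t})"
    by (auto intro!: derivative_eq_intros)
qed

lemma deriv_seq_diff:
  "deriv_seq S \<phi> \<Longrightarrow> deriv_seq S \<psi> \<Longrightarrow> deriv_seq S (\<lambda>k x. \<phi> k x - \<psi> k x)"
  unfolding deriv_seq_def by (auto intro: has_vector_derivative_diff)

text \<open>The $n$-fold antiderivative that vanishes to order $n$ at 0: integrating from 0 at each step
  puts the old Taylor coefficients at the indices from $n$ on and zeros below.\<close>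
lemma deriv_seq_antiderivative:
  assumes "deriv_seq {0..t} e" 
  obtains E where "deriv_seq {0..t} E" "\<And>j. E (n + j) = e j" "\<And>k. k < n \<Longrightarrow> E k 0 = 0"
proof (induction n arbitrary: thesis)
  case 0
  then show ?case using assms by (metis add_0 not_less_zero)
next
  case (Suc n)
  obtain E where E: "deriv_seq {0..t} E" "\<And>j. E (n + j) = e j" "\<And>k. k < n \<Longrightarrow> E k 0 = 0"
    using Suc.IH by blast
  define E' where "E' = (\<lambda>k. case k of 0 \<Rightarrow> (\<lambda>u. integral {0..u} (E 0)) | Suc m \<Rightarrow> E m)"
  show ?case
  proof (rule Suc.prems)
    show "deriv_seq {0..t} E'"
      unfolding deriv_seq_def
    proof (intro allI ballI)
      fix k x assume "x \<in> {0..t}"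
      then show "(E' k has_vector_derivative E' (Suc k) x) (at x within {0..t})"
        using E(1) integral_has_vector_derivative[OF deriv_seq_continuous_on[OF E(1)]]
        unfolding E'_def deriv_seq_def by (cases k) auto
    qed
    show "E' (Suc n + j) = e j" for j using E(2) by (simp add: E'_def)
    show "E' k 0 = 0" if "k < Suc n" for k using that E(3) by (cases k) (auto simp: E'_def)
  qed
qed

section \<open>Taylor expansion and uniqueness of expansions in real powers\<close>

lemma deriv_seq_taylor:
  assumes \<phi>: "deriv_seq {0..t} \<phi>" and "0 < m" and u: "u \<in> {0..t}"
  shows "\<phi> 0 u = (\<Sum>k<m. complex_of_real (u ^ k / fact k) * \<phi> k 0) +
     integral {0..u} (\<lambda>x. ((u - x) ^ (m - 1) / fact (m - 1)) *\<^sub>R \<phi> m x)"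
proof -
  have "(\<phi> k has_vector_derivative \<phi> (Suc k) x) (at x within {0..u})" if "0 \<le> x" "x \<le> u" for k x
    using deriv_seq_subset[OF \<phi>, of "{0..u}"] that u unfolding deriv_seq_def by auto
  then show ?thesis
    using Taylor_integral[OF \<open>0 < m\<close>, where Df = \<phi> and f = "\<phi> 0" and a = 0 and b = u] u
    by (simp add: scaleR_conv_of_real)
qed

lemma deriv_seq_taylor_bound:
  assumes \<phi>: "deriv_seq {0..t} \<phi>" and "0 < m"
  obtains B where "\<And>u. u \<in> {0..t} \<Longrightarrow>
    norm (\<phi> 0 u - (\<Sum>k<m. complex_of_real (u ^ k / fact k) * \<phi> k 0)) \<le> B * u ^ m"
proof -
  have "compact (\<phi> m ` {0..t})"
    using deriv_seq_continuous_on[OF \<phi>] by (intro compact_continuous_image) auto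
  then obtain B where B: "\<And>x. x \<in> {0..t} \<Longrightarrow> norm (\<phi> m x) \<le> B"
    by (meson bounded_iff compact_imp_bounded imageI)
  have "norm (\<phi> 0 u - (\<Sum>k<m. complex_of_real (u ^ k / fact k) * \<phi> k 0)) \<le> B * u ^ m"
    if u: "u \<in> {0..t}" for u
  proof -
    let ?i = "\<lambda>x. ((u - x) ^ (m - 1) / fact (m - 1)) *\<^sub>R \<phi> m x"
    have sub: "{0..u} \<subseteq> {0..t}" using u by auto
    have "norm (integral {0..u} ?i) \<le> (B * u ^ (m - 1)) * (u - 0)"
    proof (rule integral_bound)
      show "0 \<le> u" using u by simp
      show "continuous_on {0..u} ?i"
        using continuous_on_subset[OF deriv_seq_continuous_on[OF \<phi>] sub]
        by (intro continuous_intros) auto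
      fix x assume x: "x \<in> {0..u}"
      have "(u - x) ^ (m - 1) / fact (m - 1) \<le> u ^ (m - 1) / 1"
        using x by (intro frac_le power_mono) (auto simp: fact_ge_1)
      then have "(u - x) ^ (m - 1) / fact (m - 1) * norm (\<phi> m x) \<le> u ^ (m - 1) * B"
        using B[of x] x u by (intro mult_mono) auto
      then show "norm (?i x) \<le> B * u ^ (m - 1)"
        using x by (simp add: mult.commute)
    qed
    also have "\<dots> = B * u ^ m"
      using \<open>0 < m\<close> by (metis diff_zero mult.assoc power_minus_mult)
    finally show ?thesis
      using deriv_seq_taylor[OF \<phi> \<open>0 < m\<close> u] by simp
  qed
  then show ?thesis using that by blast
qed

lemma deriv_seq_taylor_exact:
  assumes \<phi>: "deriv_seq {0..t} \<phi>" and "0 < m" and u: "u \<in> {0..t}"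
    and 0: "\<And>x. x \<in> {0..t} \<Longrightarrow> \<phi> m x = 0"
  shows "\<phi> 0 u = (\<Sum>k<m. complex_of_real (u ^ k / fact k) * \<phi> k 0)"
proof -
  have "integral {0..u} (\<lambda>x. ((u - x) ^ (m - 1) / fact (m - 1)) *\<^sub>R \<phi> m x) = integral {0..u} (\<lambda>x. 0)"
    by (rule integral_cong) (use 0 u in auto)
  then show ?thesis using deriv_seq_taylor[OF assms(1-3)] by simp
qed

text \<open>Divide by the smallest power and let $u$ tend to 0: all other terms and the bound vanish in the
  limit, so the coefficient of the smallest power is 0. Then it can be dropped.\<close>
lemma power_sum_negligible_imp_zero:
  fixes c :: "real \<Rightarrow> complex"
  assumes "finite G" "\<And>\<delta>. \<delta> \<in> G \<Longrightarrow> \<delta> < m" "t > 0"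
    and "\<And>u. u \<in> {0<..t} \<Longrightarrow> norm (\<Sum>\<delta>\<in>G. complex_of_real (u powr \<delta>) * c \<delta>) \<le> B * u powr m"
  shows "\<forall>\<delta>\<in>G. c \<delta> = 0"
  using assms(1,2,4)
proof (induction G rule: finite_linorder_min_induct)
  case (insert b A)
  let ?R = "\<lambda>u. \<Sum>\<delta>\<in>A. complex_of_real (u powr (\<delta> - b)) * c \<delta>"
  have b: "b \<notin> A" using insert.hyps by auto
  have pw0: "((\<lambda>u. u powr d) \<longlongrightarrow> 0) (at_right (0::real))" if "d > 0" for d
  proof -
    have "((\<lambda>u. u powr d) \<longlongrightarrow> 0 powr d) (at_right (0::real))"
      using that by (intro tendsto_powr2 tendsto_intros)
        (auto simp: eventually_at_right_less eventually_at_filter)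
    then show ?thesis using that by simp
  qed
  have ev: "\<forall>\<^sub>F u in at_right 0. u \<in> {0<..t}"
    using \<open>t > 0\<close> eventually_at_right_real[of 0 t] by (auto elim: eventually_mono)
  have "((\<lambda>u. c b + ?R u) \<longlongrightarrow> c b + (\<Sum>\<delta>\<in>A. complex_of_real 0 * c \<delta>)) (at_right 0)"
    using insert.hyps by (intro tendsto_intros pw0) auto
  then have L: "((\<lambda>u. c b + ?R u) \<longlongrightarrow> c b) (at_right 0)" by simp
  have "((\<lambda>u. B * u powr (m - b)) \<longlongrightarrow> B * 0) (at_right 0)"
    using insert.prems by (intro tendsto_intros pw0) auto
  then have B: "((\<lambda>u. B * u powr (m - b)) \<longlongrightarrow> 0) (at_right 0)" by simp
  have "norm (c b + ?R u) \<le> B * u powr (m - b)" if u: "u \<in> {0<..t}" for u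
  proof -
    have "(\<Sum>\<delta>\<in>insert b A. complex_of_real (u powr \<delta>) * c \<delta>) = complex_of_real (u powr b) * (c b + ?R u)"
      using b insert.hyps
      by (simp add: sum_distrib_left distrib_left mult.assoc[symmetric] powr_add[symmetric]
          flip: of_real_mult)
    then have "u powr b * norm (c b + ?R u) \<le> B * u powr m"
      using insert.prems(2)[OF u] by (simp add: norm_mult)
    then show ?thesis using u by (simp add: powr_diff field_simps)
  qed
  then have "\<forall>\<^sub>F u in at_right 0. norm (c b + ?R u) \<le> B * u powr (m - b)"
    using ev by (auto elim: eventually_mono)
  then have "((\<lambda>u. c b + ?R u) \<longlongrightarrow> 0) (at_right 0)"
    by (rule Lim_null_comparison[OF _ B])
  then have cb: "c b = 0"
    using tendsto_unique[OF trivial_limit_at_right_real L] by blast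
  then have "\<forall>\<delta>\<in>A. c \<delta> = 0"
    using insert.prems insert.hyps(1) b by (intro insert.IH) auto
  with cb show ?case by simp
qed simp

text \<open>Subtracting the Taylor polynomial of order $m$ from the given expansion leaves a finite
  combination of real powers that is $O(u^m)$, with $m$ larger than every exponent. Its
  coefficients, collected over the union of both sets of exponents, therefore vanish: nonintegral
  exponents meet no Taylor term, and integral ones must agree with it.\<close>
lemma real_power_expansion_unique:
  fixes \<beta> :: "real \<Rightarrow> complex"
  assumes E: "deriv_seq {0..t} E" and "t > 0" and "finite G"
    and eq: "\<And>u. u \<in> {0<..t} \<Longrightarrow> E 0 u = (\<Sum>\<delta>\<in>G. complex_of_real (u powr \<delta>) * \<beta> \<delta>)"
  shows "E k 0 = (if real k \<in> G then fact k * \<beta> (real k) else 0)"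
    and "\<delta> \<in> G \<Longrightarrow> \<delta> \<notin> \<nat> \<Longrightarrow> \<beta> \<delta> = 0"
proof -
  obtain m where m: "\<And>\<delta>. \<delta> \<in> insert (real k) G \<Longrightarrow> \<delta> < real m"
    using \<open>finite G\<close> by (metis finite_insert finite_nat_set_iff_bounded[of "{}"] Max_ge reals_Archimedean2 order_le_less_trans)
  then have "m > 0" "k < m" by fastforce+
  let ?H = "real ` {..<m}"
  define c where "c \<delta> = (if \<delta> \<in> G then \<beta> \<delta> else 0) -
      (if \<delta> \<in> ?H then E (nat \<lfloor>\<delta>\<rfloor>) 0 / fact (nat \<lfloor>\<delta>\<rfloor>) else 0)" for \<delta>
  obtain B where B: "\<And>u. u \<in> {0..t} \<Longrightarrow>
      norm (E 0 u - (\<Sum>k<m. complex_of_real (u ^ k / fact k) * E k 0)) \<le> B * u ^ m"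
    using deriv_seq_taylor_bound[OF E \<open>m > 0\<close>] by blast
  have "\<forall>\<delta>\<in>G \<union> ?H. c \<delta> = 0"
  proof (rule power_sum_negligible_imp_zero)
    show "finite (G \<union> ?H)" using \<open>finite G\<close> by simp
    show "\<delta> < real m" if "\<delta> \<in> G \<union> ?H" for \<delta> using that m by auto
    show "t > 0" by fact
    fix u assume u: "u \<in> {0<..t}"
    let ?p = "\<lambda>\<delta>. complex_of_real (u powr \<delta>)"
    have "(\<Sum>\<delta>\<in>G \<union> ?H. ?p \<delta> * c \<delta>) =
        (\<Sum>\<delta>\<in>G \<union> ?H. (if \<delta> \<in> G then ?p \<delta> * \<beta> \<delta> else 0)) -
        (\<Sum>\<delta>\<in>G \<union> ?H. (if \<delta> \<in> ?H then ?p \<delta> * (E (nat \<lfloor>\<delta>\<rfloor>) 0 / fact (nat \<lfloor>\<delta>\<rfloor>)) else 0))"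
      unfolding sum_subtractf[symmetric] c_def by (intro sum.cong) (auto simp: algebra_simps)
    also have "(\<Sum>\<delta>\<in>G \<union> ?H. (if \<delta> \<in> G then ?p \<delta> * \<beta> \<delta> else 0)) = (\<Sum>\<delta>\<in>G. ?p \<delta> * \<beta> \<delta>)"
      using \<open>finite G\<close> by (intro sum.mono_neutral_cong_right) auto
    also have "(\<Sum>\<delta>\<in>G \<union> ?H. (if \<delta> \<in> ?H then ?p \<delta> * (E (nat \<lfloor>\<delta>\<rfloor>) 0 / fact (nat \<lfloor>\<delta>\<rfloor>)) else 0)) =
        (\<Sum>\<delta>\<in>?H. ?p \<delta> * (E (nat \<lfloor>\<delta>\<rfloor>) 0 / fact (nat \<lfloor>\<delta>\<rfloor>)))"
      using \<open>finite G\<close> by (intro sum.mono_neutral_cong_right) auto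
    also have "\<dots> = (\<Sum>k<m. complex_of_real (u ^ k / fact k) * E k 0)"
      using u by (subst sum.reindex) (auto simp: inj_on_def powr_realpow)
    finally show "norm (\<Sum>\<delta>\<in>G \<union> ?H. ?p \<delta> * c \<delta>) \<le> B * u powr (real m)"
      using B[of u] eq[OF u] u by (simp add: powr_realpow)
  qed
  then have c0: "c \<delta> = 0" if "\<delta> \<in> G \<union> ?H" for \<delta> using that by blast
  have "c (real k) = 0" using \<open>k < m\<close> by (intro c0) auto
  then show "E k 0 = (if real k \<in> G then fact k * \<beta> (real k) else 0)"
    using \<open>k < m\<close> unfolding c_def by (auto simp: field_simps split: if_splits)
  show "\<beta> \<delta> = 0" if "\<delta> \<in> G" "\<delta> \<notin> \<nat>"
    using c0[of \<delta>] that unfolding c_def by auto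
qed

section \<open>Flat test functions\<close>

definition flat_seq :: "real \<Rightarrow> (nat \<Rightarrow> real \<Rightarrow> complex) \<Rightarrow> bool" where
  "flat_seq T \<phi> \<longleftrightarrow> deriv_seq {0..T} \<phi> \<and> (\<forall>k. \<phi> k 0 = 0)"

lemma flat_seq_flat_at_zero:
  assumes "T > 0" "flat_seq T \<phi>"
  shows "\<phi> 0 \<in> flat_at_zero T"
  using assms deriv_seq_smooth_on[OF assms(1)] deriv_seq_iter_deriv[OF assms(1), of \<phi> 0]
  unfolding flat_at_zero_def flat_seq_def by auto

lemma flat_seq_antiderivative:
  assumes "flat_seq T \<psi>"
  obtains \<phi> where "flat_seq T \<phi>" "\<phi> n = \<psi> 0"
proof -
  obtain \<phi> where \<phi>: "deriv_seq {0..T} \<phi>" "\<And>j. \<phi> (n + j) = \<psi> j" "\<And>k. k < n \<Longrightarrow> \<phi> k 0 = 0"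
    using assms deriv_seq_antiderivative unfolding flat_seq_def by metis
  have "\<phi> k 0 = 0" for k
    using \<phi>(2)[of "k - n"] \<phi>(3)[of k] assms unfolding flat_seq_def by (cases "k < n") auto
  then have "flat_seq T \<phi>" using \<phi>(1) unfolding flat_seq_def by blast
  then show ?thesis using that \<phi>(2)[of 0] by simp
qed

text \<open>Leibniz' rule for the product with the variable. At $k = 0$ the truncated index $k - 1$ is
  harmless because of the factor $k$.\<close>
lemma flat_seq_times_id:
  assumes "flat_seq T \<phi>"
  shows "flat_seq T (\<lambda>k s. of_real s * \<phi> k s + of_nat k * \<phi> (k - 1) s)"
  unfolding flat_seq_def deriv_seq_def
proof (intro conjI allI ballI)
  fix k s assume s: "s \<in> {0..T}"
  have d: "(\<phi> j has_vector_derivative \<phi> (Suc j) s) (at s within {0..T})" for j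
    using assms s unfolding flat_seq_def deriv_seq_def by blast
  have 1: "((\<lambda>s. of_real s * \<phi> k s) has_vector_derivative of_real s * \<phi> (Suc k) s + 1 * \<phi> k s)
      (at s within {0..T})"
    by (intro has_vector_derivative_mult d) (auto intro!: derivative_eq_intros)
  have 2: "((\<lambda>s. of_nat k * \<phi> (k - 1) s) has_vector_derivative of_nat k * \<phi> k s) (at s within {0..T})"
    using d[of "k - 1"] by (cases k) (auto intro!: derivative_eq_intros)
  show "((\<lambda>s. of_real s * \<phi> k s + of_nat k * \<phi> (k - 1) s) has_vector_derivative
      of_real s * \<phi> (Suc k) s + of_nat (Suc k) * \<phi> (Suc k - 1) s) (at s within {0..T})"
    using has_vector_derivative_add[OF 1 2] by (simp add: algebra_simps)
qed (use assms in \<open>auto simp: flat_seq_def\<close>)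

text \<open>The classical flat function $e^{-1/s}$ together with the factors $p(1/s)$ that its derivatives
  carry: differentiation replaces $p(x)$ by $x^2 (p(x) - p'(x))$.\<close>
definition flat_exp :: "real poly \<Rightarrow> real \<Rightarrow> real" where
  "flat_exp p s = (if s \<le> 0 then 0 else poly p (1 / s) * exp (- (1 / s)))"

lemma poly_times_exp_tendsto_0: "((\<lambda>x::real. poly q x * exp (- x)) \<longlongrightarrow> 0) at_top"
proof -
  have "((\<lambda>x::real. \<Sum>i\<le>degree q. coeff q i * (x ^ i / exp x)) \<longlongrightarrow> (\<Sum>i\<le>degree q. coeff q i * 0)) at_top"
    by (intro tendsto_intros tendsto_power_div_exp_0)
  then show ?thesis
    by (simp add: poly_altdef exp_minus divide_inverse sum_distrib_right mult.assoc)
qed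

lemma flat_exp_deriv:
  assumes "s \<in> {0..T}" "T > 0"
  shows "(flat_exp p has_real_derivative flat_exp ([:0, 0, 1:] * (p - pderiv p)) s) (at s within {0..T})"
proof (cases "s = 0")
  case True
  have "((\<lambda>y. poly (pCons 0 p) (inverse y) * exp (- inverse y)) \<longlongrightarrow> 0) (at_right (0::real))"
    using filterlim_compose[OF poly_times_exp_tendsto_0 filterlim_inverse_at_top_right] .
  then have "((\<lambda>y. (flat_exp p y - flat_exp p 0) / (y - 0)) \<longlongrightarrow> 0) (at_right 0)"
    by (rule tendsto_cong[THEN iffD1, rotated])
      (auto simp: eventually_at_filter flat_exp_def divide_inverse intro!: always_eventually)
  then show ?thesis
    using True assms at_within_Icc_at_right[of 0 T]
    by (simp add: has_field_derivative_iff flat_exp_def)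
next
  case False
  then have s: "s > 0" using assms by simp
  have "((\<lambda>s. poly p (1 / s) * exp (- (1 / s))) has_real_derivative
      flat_exp ([:0, 0, 1:] * (p - pderiv p)) s) (at s)"
    using s by (auto intro!: derivative_eq_intros DERIV_chain'[OF _ poly_DERIV]
        simp: flat_exp_def field_simps power2_eq_square)
  then have "(flat_exp p has_real_derivative flat_exp ([:0, 0, 1:] * (p - pderiv p)) s) (at s)"
    by (rule has_field_derivative_transform_within_open[where S = "{0<..}"])
      (use s in \<open>auto simp: flat_exp_def\<close>)
  then show ?thesis by (rule has_field_derivative_at_within)
qed

lemma flat_seq_exp_power:
  assumes "T > 0"
  obtains \<phi> where "flat_seq T \<phi>" "\<And>s. \<phi> 0 s = of_real (s ^ n * flat_exp 1 s)"
proof (induction n arbitrary: thesis)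
  case 0
  define P where "P k = ((\<lambda>p. [:0, 0, 1:] * (p - pderiv p)) ^^ k) (1 :: real poly)" for k
  define \<phi> where "\<phi> k s = complex_of_real (flat_exp (P k) s)" for k s
  have "flat_seq T \<phi>"
    unfolding flat_seq_def deriv_seq_def
  proof (intro conjI allI ballI)
    fix k s assume "s \<in> {0..T}"
    from flat_exp_deriv[OF this assms, of "P k"]
    show "(\<phi> k has_vector_derivative \<phi> (Suc k) s) (at s within {0..T})"
      unfolding \<phi>_def
      by (intro has_vector_derivative_of_real) (simp add: P_def has_real_derivative_iff_has_vector_derivative)
  qed (simp add: \<phi>_def flat_exp_def)
  then show ?case
    by (rule 0) (simp add: \<phi>_def P_def)
next
  case (Suc n)
  obtain \<phi> where \<phi>: "flat_seq T \<phi>" "\<And>s. \<phi> 0 s = of_real (s ^ n * flat_exp 1 s)"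
    using Suc.IH by blast
  show ?case
    by (rule Suc.prems[OF flat_seq_times_id[OF \<phi>(1)]]) (simp add: \<phi>(2))
qed

lemma continuous_on_flat_exp: "continuous_on {0..t} (flat_exp p)"
proof (cases "t > 0")
  case True
  then show ?thesis
    using flat_exp_deriv[of _ t p] by (meson DERIV_continuous continuous_on_eq_continuous_within)
next
  case False
  then have "{0..t} \<subseteq> {0}" by auto
  then show ?thesis using continuous_on_subset continuous_on_sing by blast
qed

text \<open>By Weierstrass' theorem $r$ is a uniform limit of polynomials $g$, and $r$ is orthogonal to
  every $g h$; so the integral of $r^2 h$ vanishes, and this integrand is continuous and
  nonnegative.\<close>
lemma orthogonal_to_weighted_powers_imp_zero:
  fixes r h :: "real \<Rightarrow> real"
  assumes t: "t > 0" and r: "continuous_on {0..t} r" and h: "continuous_on {0..t} h"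
    and h0: "\<And>s. s \<in> {0..t} \<Longrightarrow> h s \<ge> 0"
    and orth: "\<And>n. integral {0..t} (\<lambda>s. r s * (s ^ n * h s)) = 0"
    and s: "s \<in> {0..t}" "h s > 0"
  shows "r s = 0"
proof -
  have cont: "continuous_on {0..t} (\<lambda>s. r s * (r s * h s))"
    by (intro continuous_intros r h)
  have poly: "integral {0..t} (\<lambda>s. r s * (g s * h s)) = 0" if "real_polynomial_function g" for g
  proof -
    obtain a n where g: "g = (\<lambda>x. \<Sum>i\<le>n. a i * x ^ i)"
      using \<open>real_polynomial_function g\<close> unfolding real_polynomial_function_iff_sum by blast
    have "(\<lambda>s. r s * (g s * h s)) = (\<lambda>s. \<Sum>i\<le>n. a i * (r s * (s ^ i * h s)))"
      unfolding g by (simp add: sum_distrib_left sum_distrib_right algebra_simps)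
    then have "integral {0..t} (\<lambda>s. r s * (g s * h s)) =
        integral {0..t} (\<lambda>s. \<Sum>i\<le>n. a i * (r s * (s ^ i * h s)))" by simp
    also have "\<dots> = (\<Sum>i\<le>n. a i * integral {0..t} (\<lambda>s. r s * (s ^ i * h s)))"
    proof (subst integral_sum)
      show "(\<lambda>s. a i * (r s * (s ^ i * h s))) integrable_on {0..t}" for i
        by (intro integrable_continuous_interval continuous_intros r h)
    qed auto
    finally show ?thesis using orth by simp
  qed
  have "compact ((\<lambda>s. r s * h s) ` {0..t})"
    by (intro compact_continuous_image continuous_intros r h) auto
  then obtain M where M: "\<And>s. s \<in> {0..t} \<Longrightarrow> norm (r s * h s) \<le> M"
    by (meson bounded_iff compact_imp_bounded imageI)
  have "norm (r 0 * h 0) \<le> M" using t by (intro M) simp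
  then have "M \<ge> 0" using norm_ge_zero order_trans by blast
  have "norm (integral {0..t} (\<lambda>s. r s * (r s * h s))) \<le> e" if "e > 0" for e
  proof -
    \<comment> \<open>the summand 1 only keeps the denominator positive\<close>
    define d where "d = e / (M * t + 1)"
    have "d > 0" using \<open>e > 0\<close> \<open>M \<ge> 0\<close> t unfolding d_def by (simp add: add_nonneg_pos)
    then obtain g where g: "real_polynomial_function g" "\<And>x. x \<in> {0..t} \<Longrightarrow> \<bar>r x - g x\<bar> < d"
      using Stone_Weierstrass_real_polynomial_function[OF compact_Icc r] by blast
    have gc: "continuous_on {0..t} g"
      using g(1) continuous_on_polymonial_function real_polynomial_function_eq by blast
    have "integral {0..t} (\<lambda>s. r s * (r s * h s)) =
        integral {0..t} (\<lambda>s. r s * (r s * h s)) - integral {0..t} (\<lambda>s. r s * (g s * h s))"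
      using poly[OF g(1)] by simp
    also have "\<dots> = integral {0..t} (\<lambda>s. r s * (r s * h s) - r s * (g s * h s))"
      by (intro integral_diff[symmetric] integrable_continuous_interval continuous_intros r h gc)
    also have "norm \<dots> \<le> (M * d) * (t - 0)"
    proof (rule integral_bound)
      show "continuous_on {0..t} (\<lambda>s. r s * (r s * h s) - r s * (g s * h s))"
        by (intro continuous_intros r h gc)
      fix s assume s: "s \<in> {0..t}"
      have "norm (r s * (r s * h s) - r s * (g s * h s)) = norm (r s * h s) * \<bar>r s - g s\<bar>"
        by (simp add: algebra_simps flip: abs_mult)
      also have "\<dots> \<le> M * d"
        using M[OF s] g(2)[OF s] by (intro mult_mono) auto
      finally show "norm (r s * (r s * h s) - r s * (g s * h s)) \<le> M * d" .
    qed (use t in simp)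
    also have "\<dots> \<le> e"
    proof -
      have "e = d * (M * t + 1)"
        using \<open>M \<ge> 0\<close> t unfolding d_def by (simp add: add_nonneg_eq_0_iff)
      then show ?thesis using \<open>d > 0\<close> by (simp add: algebra_simps)
    qed
    finally show ?thesis .
  qed
  then have "integral {0..t} (\<lambda>s. r s * (r s * h s)) = 0"
    using dense_ge[of 0 "norm (integral {0..t} (\<lambda>s. r s * (r s * h s)))"] by simp
  moreover have "0 \<le> r x * (r x * h x)" if "x \<in> {0..t}" for x
    using h0[OF that] by (simp add: mult.assoc[symmetric])
  ultimately have "r s * (r s * h s) = 0"
    using integral_eq_0_iff[OF cont t] s(1) by blast
  then show ?thesis using s(2) by simp
qed

text \<open>The flat functions $s^n e^{-1/s}$ alone suffice: their weight is positive away from 0, and the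
  powers of $s$ span the polynomials, which are uniformly dense.\<close>
lemma orthogonal_to_flat_imp_zero:
  assumes t: "0 < t" "t \<le> T" and \<kappa>: "continuous_on {0..t} \<kappa>"
    and orth: "\<And>\<psi>. flat_seq T \<psi> \<Longrightarrow> integral {0..t} (\<lambda>s. \<kappa> s * \<psi> 0 s) = 0"
    and s: "s \<in> {0<..t}"
  shows "\<kappa> s = 0"
proof -
  let ?g = "\<lambda>n s. s ^ n * flat_exp 1 s"
  have int0: "integral {0..t} (\<lambda>s. \<kappa> s * of_real (?g n s)) = 0" for n
  proof -
    have "T > 0" using t by simp
    then obtain \<psi> where \<psi>: "flat_seq T \<psi>" "\<And>s. \<psi> 0 s = of_real (?g n s)"
      using flat_seq_exp_power by blast
    show ?thesis using orth[OF \<psi>(1)] unfolding \<psi>(2) .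
  qed
  have int: "(\<lambda>s. \<kappa> s * of_real (?g n s)) integrable_on {0..t}" for n
    by (intro integrable_continuous_interval continuous_intros \<kappa> continuous_on_flat_exp)
  have *: "((\<lambda>s. \<kappa> s * of_real (?g n s)) has_integral 0) {0..t}" for n
    using integrable_integral[OF int[of n]] unfolding int0 .
  have re: "integral {0..t} (\<lambda>s. Re (\<kappa> s) * ?g n s) = 0" for n
    using has_integral_linear[OF * bounded_linear_Re, of n] by (intro integral_unique) (simp add: o_def)
  have im: "integral {0..t} (\<lambda>s. Im (\<kappa> s) * ?g n s) = 0" for n
    using has_integral_linear[OF * bounded_linear_Im, of n] by (intro integral_unique) (simp add: o_def)
  have pos: "flat_exp 1 s > 0" "\<And>s. flat_exp 1 s \<ge> 0"
    using s by (auto simp: flat_exp_def)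
  have s': "s \<in> {0..t}" using s by simp
  have "Re (\<kappa> s) = 0"
    using orthogonal_to_weighted_powers_imp_zero[OF t(1) _ continuous_on_flat_exp pos(2) re s' pos(1)]
      continuous_on_Re[OF \<kappa>] .
  moreover have "Im (\<kappa> s) = 0"
    using orthogonal_to_weighted_powers_imp_zero[OF t(1) _ continuous_on_flat_exp pos(2) im s' pos(1)]
      continuous_on_Im[OF \<kappa>] .
  ultimately show ?thesis by (simp add: complex_eq_iff)
qed

section \<open>Fractional operators and convolutions\<close>

text \<open>For integral order the kernel $(t - s)^j / j!$ differs from the one with real exponent at most
  at the single point $s = t$, where 0 powr 0 is 0 but $0^0 = 1$.\<close>
lemma frac_int_nat:
  "frac_int (real (Suc j)) f t = integral {0..t} (\<lambda>s. complex_of_real ((t - s) ^ j / fact j) * f s)"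
proof -
  have "integral {0..t} (\<lambda>s. complex_of_real ((t - s) powr (real (Suc j) - 1)) * f s) =
      integral {0..t} (\<lambda>s. complex_of_real ((t - s) ^ j) * f s)"
    by (rule integral_spike[of "{t}"]) (auto simp: powr_realpow)
  moreover have "integral {0..t} (\<lambda>s. complex_of_real (1 / fact j) * (complex_of_real ((t - s) ^ j) * f s)) =
      complex_of_real (1 / fact j) * integral {0..t} (\<lambda>s. complex_of_real ((t - s) ^ j) * f s)"
    by (rule integral_mult_right)
  moreover have "Gamma (real (Suc j)) = fact j"
    using Gamma_fact[of j, where 'a = real] by (simp add: add.commute)
  ultimately show ?thesis
    unfolding frac_int_def by (simp add: mult.assoc[symmetric])
qed

lemma frac_int_flat_seq:
  assumes T: "T > 0" and \<phi>: "flat_seq T \<phi>" and \<mu>: "\<mu> > 0" and t: "t \<in> {0..T}"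
  shows "frac_int (\<mu> + real n) (\<phi> n) t = frac_int \<mu> (\<phi> 0) t"
proof (induction n)
  case (Suc n)
  have d: "deriv_seq {0..T} \<phi>" and 0: "\<phi> n 0 = 0"
    using \<phi> unfolding flat_seq_def by auto
  have v: "vector_derivative (\<phi> n) (at s within {0..T}) = \<phi> (Suc n) s" if "s \<in> {0..T}" for s
    using d that vector_derivative_within_closed_interval[OF T that] unfolding deriv_seq_def by blast
  have "frac_int (\<mu> + real (Suc n)) (\<phi> (Suc n)) t =
      frac_int (\<mu> + real n + 1) (\<lambda>s. vector_derivative (\<phi> n) (at s within {0..T})) t"
  proof -
    have "integral {0..t} (\<lambda>s. complex_of_real ((t - s) powr (\<mu> + real (Suc n) - 1)) * \<phi> (Suc n) s) =
      integral {0..t} (\<lambda>s. complex_of_real ((t - s) powr (\<mu> + real n + 1 - 1)) *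
        vector_derivative (\<phi> n) (at s within {0..T}))"
      using t v by (intro integral_cong) (auto simp: algebra_simps)
    then show ?thesis unfolding frac_int_def by (simp add: algebra_simps)
  qed
  also have "\<dots> = frac_int (\<mu> + real n) (\<phi> n) t"
    using \<mu> by (intro frac_int_deriv[OF T _ deriv_seq_smooth_on[OF T d] 0 t]) simp
  finally show ?case using Suc.IH by simp
qed simp

text \<open>One formula for all orders: writing $f = J^n g$ with $n > \gamma$ turns every operator,
  including the derivatives of integral order and the identity, into a fractional integral of
  $g = f^{(n)}$.\<close>
lemma frac_op_flat_seq:
  assumes T: "T > 0" and \<phi>: "flat_seq T \<phi>" and n: "real n > \<gamma>" "n > 0" and t: "t \<in> {0..T}"
  shows "frac_op T \<gamma> (\<phi> 0) t = frac_int (real n - \<gamma>) (\<phi> n) t"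
proof -
  have d: "deriv_seq {0..T} \<phi>" and 0: "\<phi> k 0 = 0" for k
    using \<phi> unfolding flat_seq_def by auto
  consider "\<gamma> < 0" | "\<gamma> = 0" | "\<gamma> > 0" by linarith
  then show ?thesis
  proof cases
    case 1
    then show ?thesis
      using frac_int_flat_seq[OF T \<phi> _ t, of "- \<gamma>" n] by (simp add: frac_op_def add.commute)
  next
    case 2
    have "(\<phi> 1 has_integral \<phi> 0 t - \<phi> 0 0) {0..t}"
    proof (rule fundamental_theorem_of_calculus)
      fix x assume "x \<in> {0..t}"
      then show "(\<phi> 0 has_vector_derivative \<phi> 1 x) (at x within {0..t})"
        using deriv_seq_subset[OF d, of "{0..t}"] t unfolding deriv_seq_def by auto
    qed (use t in simp)
    then have "\<phi> 0 t = integral {0..t} (\<phi> 1)"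
      using 0 by (simp add: integral_unique)
    also have "\<dots> = frac_int 1 (\<phi> 1) t"
      using frac_int_nat[of 0 "\<phi> 1" t] by simp
    also have "\<dots> = frac_int (1 + real (n - 1)) (\<phi> (1 + (n - 1))) t"
    proof -
      have "flat_seq T (\<lambda>k. \<phi> (1 + k))"
        using deriv_seq_tail[OF d] 0 unfolding flat_seq_def by blast
      from frac_int_flat_seq[OF T this _ t, of 1 "n - 1"] show ?thesis by simp
    qed
    finally show ?thesis using 2 n by (simp add: frac_op_def)
  next
    case 3
    have "frac_op T \<gamma> (\<phi> 0) t = frac_int (real n - \<gamma>) (iter_deriv {0..T} n (\<phi> 0)) t"
      by (rule frac_op_eq[OF T flat_seq_flat_at_zero[OF T \<phi>] 3 n(1) t])
    also have "\<dots> = frac_int (real n - \<gamma>) (\<phi> n) t"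
      unfolding frac_int_def
      using t deriv_seq_iter_deriv[OF T d] by (auto intro!: arg_cong2[where f = "(*)"] integral_cong)
    finally show ?thesis .
  qed
qed

text \<open>Integration by parts moves the derivatives from one factor to the other. The boundary term at
  $s = 0$ vanishes by $\phi$, the one at $s = t$ by $E$.\<close>
lemma convolution_by_parts:
  assumes t: "0 \<le> t" and E: "deriv_seq {0..t} E" and \<phi>: "deriv_seq {0..t} \<phi>"
    and E0: "\<And>k. k < n \<Longrightarrow> E k 0 = 0" and \<phi>0: "\<And>k. k < n \<Longrightarrow> \<phi> k 0 = 0"
  shows "integral {0..t} (\<lambda>s. E n (t - s) * \<phi> 0 s) = integral {0..t} (\<lambda>s. E 0 (t - s) * \<phi> n s)"
  using E \<phi> E0 \<phi>0
proof (induction n arbitrary: \<phi>)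
  case (Suc n)
  have cE: "continuous_on {0..t} (\<lambda>s. E k (t - s))" for k
    by (rule continuous_on_compose2[OF deriv_seq_continuous_on[OF Suc.prems(1)]])
      (auto intro!: continuous_intros)
  have c\<phi>: "continuous_on {0..t} (\<phi> k)" for k
    by (rule deriv_seq_continuous_on[OF Suc.prems(2)])
  have "((\<lambda>s. E n (t - s) * \<phi> 1 s - E (Suc n) (t - s) * \<phi> 0 s) has_integral
      E n (t - t) * \<phi> 0 t - E n (t - 0) * \<phi> 0 0) {0..t}"
  proof (rule fundamental_theorem_of_calculus_interior[OF t])
    show "continuous_on {0..t} (\<lambda>s. E n (t - s) * \<phi> 0 s)"
      by (intro continuous_intros cE c\<phi>)
    fix s assume s: "s \<in> {0<..<t}"
    have "((\<lambda>s. t - s) has_vector_derivative -1) (at s)"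
      by (auto intro!: derivative_eq_intros)
    moreover have "(E n has_vector_derivative E (Suc n) (t - s)) (at (t - s))"
      using s by (intro deriv_seq_at[OF Suc.prems(1)]) auto
    ultimately have "((\<lambda>s. E n (t - s)) has_vector_derivative - E (Suc n) (t - s)) (at s)"
      using vector_diff_chain_at by (fastforce simp: o_def)
    from has_vector_derivative_mult[OF this deriv_seq_at[OF Suc.prems(2) s, of 0]]
    show "((\<lambda>s. E n (t - s) * \<phi> 0 s) has_vector_derivative
        E n (t - s) * \<phi> 1 s - E (Suc n) (t - s) * \<phi> 0 s) (at s)"
      by simp
  qed
  then have "integral {0..t} (\<lambda>s. E n (t - s) * \<phi> 1 s - E (Suc n) (t - s) * \<phi> 0 s) = 0"
    using Suc.prems(3)[of n] Suc.prems(4)[of 0] by (simp add: integral_unique)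
  moreover have "integral {0..t} (\<lambda>s. E n (t - s) * \<phi> 1 s - E (Suc n) (t - s) * \<phi> 0 s) =
      integral {0..t} (\<lambda>s. E n (t - s) * \<phi> 1 s) - integral {0..t} (\<lambda>s. E (Suc n) (t - s) * \<phi> 0 s)"
    by (intro integral_diff integrable_continuous_interval continuous_intros cE c\<phi>)
  ultimately have "integral {0..t} (\<lambda>s. E (Suc n) (t - s) * \<phi> 0 s) =
      integral {0..t} (\<lambda>s. E n (t - s) * \<phi> (1 + 0) s)" by simp
  also have "\<dots> = integral {0..t} (\<lambda>s. E 0 (t - s) * \<phi> (1 + n) s)"
    using Suc.prems by (intro Suc.IH deriv_seq_tail) auto
  finally show ?case by simp
qed simp

text \<open>Writing each $f$ as $J^n g$ makes both sides integrals against $g$ with continuous kernels, the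
  left one being the $n$-fold antiderivative $E$ of $e$. Since $g$ is an arbitrary flat function,
  the kernels agree:
  $E(u) = \sum_\gamma \beta_\gamma u^{n-\gamma-1} / \Gamma(n-\gamma)$.
  The function $E$ is smooth and vanishes to order $n$ at 0, so no nonintegral exponent and no
  exponent below $n$ occurs, that is, only negative integers $\gamma$ contribute. At the exponent
  $n + j$, which belongs to $\gamma = -(j+1)$, the Taylor coefficient is $e^{(j)}(0) / (n+j)!$ and
  the Gamma factor is the same factorial.\<close>
lemma coefficients_of_convolution:
  assumes t: "0 < t" "t \<le> T" and e: "deriv_seq {0..t} e" and F: "finite F"
    and id: "\<And>f. f \<in> flat_at_zero T \<Longrightarrow>
      integral {0..t} (\<lambda>s. e 0 (t - s) * f s) = (\<Sum>\<gamma>\<in>F. \<beta> \<gamma> * frac_op T \<gamma> f t)"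
  shows "\<gamma> \<in> F \<Longrightarrow> \<not> (\<gamma> \<in> \<int> \<and> \<gamma> < 0) \<Longrightarrow> \<beta> \<gamma> = 0"
    and "e j 0 = (if - real (Suc j) \<in> F then \<beta> (- real (Suc j)) else 0)"
proof -
  have T: "T > 0" and tT: "t \<in> {0..T}" using t by auto
  \<comment> \<open>the margin 1 makes all exponents $n - \gamma - 1$ positive, hence the kernels continuous up to $s = t$\<close>
  obtain n where n: "\<And>\<gamma>. \<gamma> \<in> insert 0 F \<Longrightarrow> \<gamma> + 1 < real n"
  proof -
    obtain n where "Max (insert 0 F) + 1 < real n" using reals_Archimedean2 by blast
    then have "\<gamma> + 1 < real n" if "\<gamma> \<in> insert 0 F" for \<gamma>
      using Max_ge[OF _ that] F by simp
    then show ?thesis using that by blast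
  qed
  have "n > 0" using n[of 0] by simp
  obtain E where E: "deriv_seq {0..t} E" "\<And>j. E (n + j) = e j" "\<And>k. k < n \<Longrightarrow> E k 0 = 0"
    using deriv_seq_antiderivative[OF e] by blast
  define c where "c \<gamma> = \<beta> \<gamma> * complex_of_real (1 / Gamma (real n - \<gamma>))" for \<gamma>
  \<comment> \<open>the difference of the two kernels against $g = f^{(n)}$\<close>
  define \<kappa> where "\<kappa> s = E 0 (t - s) - (\<Sum>\<gamma>\<in>F. c \<gamma> * complex_of_real ((t - s) powr (real n - \<gamma> - 1)))" for s
  have cE: "continuous_on {0..t} (\<lambda>s. E 0 (t - s))"
    by (rule continuous_on_compose2[OF deriv_seq_continuous_on[OF E(1)]])
      (auto intro!: continuous_intros)
  have cp: "continuous_on {0..t} (\<lambda>s. complex_of_real ((t - s) powr (real n - \<gamma> - 1)))" if "\<gamma> \<in> F" for \<gamma>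
    using n[of \<gamma>] that by (intro continuous_intros continuous_on_powr') auto
  have \<kappa>0: "\<kappa> s = 0" if "s \<in> {0<..t}" for s
  proof (rule orthogonal_to_flat_imp_zero[OF t _ _ that])
    show "continuous_on {0..t} \<kappa>"
      unfolding \<kappa>_def by (intro continuous_intros cE cp)
    fix \<psi> assume "flat_seq T \<psi>"
    then obtain \<phi> where \<phi>: "flat_seq T \<phi>" "\<phi> n = \<psi> 0" using flat_seq_antiderivative by blast
    have d\<phi>: "deriv_seq {0..t} \<phi>"
      using \<phi>(1) deriv_seq_subset[of "{0..T}" \<phi> "{0..t}"] t unfolding flat_seq_def by auto
    have c\<psi>: "continuous_on {0..t} (\<psi> 0)"
      using deriv_seq_continuous_on[OF d\<phi>, of n] \<phi>(2) by simp
    have "integral {0..t} (\<lambda>s. E 0 (t - s) * \<psi> 0 s) = integral {0..t} (\<lambda>s. e 0 (t - s) * \<phi> 0 s)"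
      using convolution_by_parts[OF _ E(1) d\<phi> E(3), of n] t \<phi> E(2)[of 0] unfolding flat_seq_def by simp
    also have "\<dots> = (\<Sum>\<gamma>\<in>F. \<beta> \<gamma> * frac_op T \<gamma> (\<phi> 0) t)"
      by (rule id[OF flat_seq_flat_at_zero[OF T \<phi>(1)]])
    also have "\<dots> = (\<Sum>\<gamma>\<in>F. c \<gamma> *
        integral {0..t} (\<lambda>s. complex_of_real ((t - s) powr (real n - \<gamma> - 1)) * \<psi> 0 s))"
    proof (rule sum.cong[OF refl])
      fix \<gamma> assume "\<gamma> \<in> F"
      then have "frac_op T \<gamma> (\<phi> 0) t = frac_int (real n - \<gamma>) (\<psi> 0) t"
        using frac_op_flat_seq[OF T \<phi>(1) _ \<open>n > 0\<close> tT, of \<gamma>] n[of \<gamma>] \<phi>(2) by simp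
      then show "\<beta> \<gamma> * frac_op T \<gamma> (\<phi> 0) t = c \<gamma> *
          integral {0..t} (\<lambda>s. complex_of_real ((t - s) powr (real n - \<gamma> - 1)) * \<psi> 0 s)"
        unfolding c_def frac_int_def by simp
    qed
    also have "\<dots> = (\<Sum>\<gamma>\<in>F. integral {0..t} (\<lambda>s. c \<gamma> * (complex_of_real ((t - s) powr (real n - \<gamma> - 1)) * \<psi> 0 s)))"
      by simp
    also have "\<dots> = integral {0..t} (\<lambda>s. \<Sum>\<gamma>\<in>F. c \<gamma> * (complex_of_real ((t - s) powr (real n - \<gamma> - 1)) * \<psi> 0 s))"
      by (intro integral_sum[symmetric] F integrable_continuous_interval continuous_intros c\<psi> cp)
    finally have "integral {0..t} (\<lambda>s. E 0 (t - s) * \<psi> 0 s) -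
        integral {0..t} (\<lambda>s. \<Sum>\<gamma>\<in>F. c \<gamma> * (complex_of_real ((t - s) powr (real n - \<gamma> - 1)) * \<psi> 0 s)) = 0"
      by simp
    moreover have "(\<lambda>s. \<kappa> s * \<psi> 0 s) = (\<lambda>s. E 0 (t - s) * \<psi> 0 s -
        (\<Sum>\<gamma>\<in>F. c \<gamma> * (complex_of_real ((t - s) powr (real n - \<gamma> - 1)) * \<psi> 0 s)))"
      unfolding \<kappa>_def by (simp add: left_diff_distrib sum_distrib_right mult.assoc)
    moreover have "integral {0..t} (\<lambda>s. E 0 (t - s) * \<psi> 0 s -
        (\<Sum>\<gamma>\<in>F. c \<gamma> * (complex_of_real ((t - s) powr (real n - \<gamma> - 1)) * \<psi> 0 s))) =
        integral {0..t} (\<lambda>s. E 0 (t - s) * \<psi> 0 s) -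
        integral {0..t} (\<lambda>s. \<Sum>\<gamma>\<in>F. c \<gamma> * (complex_of_real ((t - s) powr (real n - \<gamma> - 1)) * \<psi> 0 s))"
      by (intro integral_diff integrable_continuous_interval continuous_intros c\<psi> cp cE)
    ultimately show "integral {0..t} (\<lambda>s. \<kappa> s * \<psi> 0 s) = 0" by simp
  qed
  define G where "G = (\<lambda>\<gamma>. real n - 1 - \<gamma>) ` F"
  define b where "b \<delta> = c (real n - 1 - \<delta>)" for \<delta>
  \<comment> \<open>$\kappa(0)$ is not known to vanish, so $u = t$ is excluded; any shorter interval does\<close>
  have half: "0 < t / 2" using t by simp
  have E': "deriv_seq {0..t / 2} E" using deriv_seq_subset[OF E(1), of "{0..t / 2}"] t by auto
  have "finite G" using F unfolding G_def by simp
  have exp: "E 0 u = (\<Sum>\<delta>\<in>G. complex_of_real (u powr \<delta>) * b \<delta>)" if "u \<in> {0<..t / 2}" for u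
  proof -
    have "\<kappa> (t - u) = 0" using that t by (intro \<kappa>0) auto
    then have "E 0 u = (\<Sum>\<gamma>\<in>F. c \<gamma> * complex_of_real (u powr (real n - \<gamma> - 1)))"
      unfolding \<kappa>_def by simp
    also have "\<dots> = (\<Sum>\<delta>\<in>G. complex_of_real (u powr \<delta>) * b \<delta>)"
      unfolding G_def b_def by (subst sum.reindex) (auto simp: inj_on_def algebra_simps)
    finally show ?thesis .
  qed
  note uniq = real_power_expansion_unique[OF E' half \<open>finite G\<close> exp]
  have \<beta>_c: "\<beta> \<gamma> = c \<gamma> * complex_of_real (Gamma (real n - \<gamma>))" if "\<gamma> \<in> F" for \<gamma>
  proof -
    have "Gamma (real n - \<gamma>) > 0" using n[of \<gamma>] that by (intro Gamma_real_pos) simp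
    then show ?thesis unfolding c_def by simp
  qed
  show "\<beta> \<gamma> = 0" if \<gamma>: "\<gamma> \<in> F" "\<not> (\<gamma> \<in> \<int> \<and> \<gamma> < 0)"
  proof -
    let ?\<delta> = "real n - 1 - \<gamma>"
    have G: "?\<delta> \<in> G" using \<gamma> unfolding G_def by blast
    have "b ?\<delta> = 0"
    proof (cases "?\<delta> \<in> \<nat>")
      case True
      then obtain k where k: "?\<delta> = real k" unfolding Nats_def by auto
      then have "\<gamma> = real_of_int (int n - 1 - int k)" by simp
      then have "\<gamma> \<in> \<int>" by (metis Ints_of_int)
      then have "k < n" using \<gamma>(2) k by simp
      then show ?thesis using uniq(1)[of k] E(3)[of k] G k by simp
    next
      case False
      then show ?thesis using uniq(2)[OF _ G] by simp
    qed
    then show ?thesis using \<beta>_c[OF \<gamma>(1)] unfolding b_def by simp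
  qed
  have mem: "real (n + j) \<in> G \<longleftrightarrow> - real (Suc j) \<in> F"
  proof
    assume "real (n + j) \<in> G"
    then obtain \<gamma> where "\<gamma> \<in> F" "real (n + j) = real n - 1 - \<gamma>" unfolding G_def by blast
    moreover from this have "\<gamma> = - real (Suc j)" by simp
    ultimately show "- real (Suc j) \<in> F" by simp
  qed (auto simp: G_def intro!: image_eqI[where x = "- real (Suc j)"])
  have "Gamma (real n + real (Suc j)) = fact (n + j)"
    using Gamma_fact[of "n + j", where 'a = real] by (simp add: algebra_simps)
  then have "- real (Suc j) \<in> F \<Longrightarrow> fact (n + j) * b (real (n + j)) = \<beta> (- real (Suc j))"
    using \<beta>_c[of "- real (Suc j)"] unfolding b_def by (simp add: algebra_simps)
  then show "e j 0 = (if - real (Suc j) \<in> F then \<beta> (- real (Suc j)) else 0)"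
    using uniq(1)[of "n + j"] E(2)[of j] mem by simp
qed

section \<open>Smooth kernels on the triangle\<close>

text \<open>The derivative of the restriction to the segment is the directional derivative of $g$ along $w$,
  whichever derivative of $g$ within $S$ was chosen; so induction applies to the latter.\<close>
lemma Ck_on_line:
  fixes g :: "'a::real_normed_vector \<Rightarrow> complex"
  assumes "Ck_on k S g" "\<And>u. u \<in> {a..b} \<Longrightarrow> p + u *\<^sub>R w \<in> S" "a < b"
  shows "Ck_on k {a..b} (\<lambda>u. g (p + u *\<^sub>R w))"
  using assms(1)
proof (induction k arbitrary: g)
  case 0
  then have "continuous_on S g" by simp
  then have "continuous_on {a..b} (\<lambda>u. g (p + u *\<^sub>R w))"
    by (rule continuous_on_compose2) (use assms(2) in \<open>auto intro!: continuous_intros\<close>)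
  then show ?case by simp
next
  case (Suc k)
  define D where "D x = frechet_derivative g (at x within S)" for x
  have d: "((\<lambda>u. g (p + u *\<^sub>R w)) has_vector_derivative D (p + u *\<^sub>R w) w) (at u within {a..b})"
    if u: "u \<in> {a..b}" for u
  proof -
    let ?x = "p + u *\<^sub>R w"
    have "g differentiable (at ?x within S)" using Suc.prems assms(2)[OF u] by simp
    then have gD: "(g has_derivative D ?x) (at ?x within S)"
      unfolding D_def frechet_derivative_works .
    have "(g has_derivative D ?x) (at ?x within (\<lambda>u. p + u *\<^sub>R w) ` {a..b})"
      using assms(2) by (intro has_derivative_subset[OF gD]) auto
    moreover have "((\<lambda>u. p + u *\<^sub>R w) has_derivative (\<lambda>h. h *\<^sub>R w)) (at u within {a..b})"
      by (auto intro!: derivative_eq_intros)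
    ultimately have "((\<lambda>u. g (p + u *\<^sub>R w)) has_derivative (\<lambda>h. D ?x (h *\<^sub>R w))) (at u within {a..b})"
      using diff_chain_within[of "\<lambda>u. p + u *\<^sub>R w" "\<lambda>h. h *\<^sub>R w" u "{a..b}" g "D ?x"]
      by (simp add: o_def)
    moreover have "D ?x (h *\<^sub>R w) = h *\<^sub>R D ?x w" for h
      using has_derivative_bounded_linear[OF gD] by (simp add: bounded_linear.linear linear_cmul)
    ultimately show ?thesis unfolding has_vector_derivative_def by simp
  qed
  have "Ck_on k {a..b} (\<lambda>u. frechet_derivative (\<lambda>u. g (p + u *\<^sub>R w)) (at u within {a..b}) v)" for v
  proof (rule Ck_on_cong)
    have "Ck_on k S (\<lambda>x. D x w)" using Suc.prems unfolding D_def by simp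
    then show "Ck_on k {a..b} (\<lambda>u. v *\<^sub>R D (p + u *\<^sub>R w) w)"
      using Ck_on_scaleR[OF Suc.IH assms(3)] by blast
    show "v *\<^sub>R D (p + u *\<^sub>R w) w =
        frechet_derivative (\<lambda>u. g (p + u *\<^sub>R w)) (at u within {a..b}) v" if "u \<in> {a..b}" for u
      using frechet_derivative_interval[OF assms(3) that d[OF that]] by simp
  qed
  moreover have "(\<lambda>u. g (p + u *\<^sub>R w)) differentiable (at u within {a..b})" if "u \<in> {a..b}" for u
    using d[OF that] by (rule differentiableI_vector)
  ultimately show ?case by simp
qed

lemma smooth_kernel_slice:
  fixes K :: "real \<times> real \<Rightarrow> complex"
  assumes "smooth_on (triangle T) K" "0 < t" "t \<le> T"
  shows "smooth_on {0..t} (\<lambda>u. K (t, t - u))"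
  unfolding smooth_on_def
proof
  fix k
  have "Ck_on k {0..t} (\<lambda>u. K ((t, t) + u *\<^sub>R (0, -1)))"
  proof (rule Ck_on_line[where S = "triangle T" and g = K and p = "(t, t)" and w = "(0, -1)"])
    show "Ck_on k (triangle T) K" using assms(1) unfolding smooth_on_def by blast
    show "(t, t) + u *\<^sub>R (0, -1) \<in> triangle T" if "u \<in> {0..t}" for u
      using that assms(3) by (simp add: triangle_def)
  qed (rule assms(2))
  then show "Ck_on k {0..t} (\<lambda>u. K (t, t - u))" by simp
qed

text \<open>Restricting to the segment from $x$ to $y$ reduces the claim to uniqueness of one-sided
  derivatives in one variable.\<close>
lemma derivative_of_zero_towards:
  fixes D :: "'a::real_normed_vector \<Rightarrow> complex"
  assumes D: "((\<lambda>_. 0) has_derivative D) (at x within S)" and "convex S" "x \<in> S" "y \<in> S"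
  shows "D (y - x) = 0"
proof -
  let ?l = "\<lambda>h::real. x + h *\<^sub>R (y - x)"
  have "?l h \<in> S" if "h \<in> {0..1}" for h
  proof -
    have "?l h = (1 - h) *\<^sub>R x + h *\<^sub>R y" by (simp add: algebra_simps)
    then show ?thesis using assms(2-4) that by (simp add: convexD_alt)
  qed
  then have "((\<lambda>_. 0) has_derivative D) (at x within ?l ` {0..1})"
    by (intro has_derivative_subset[OF D]) blast
  then have "((\<lambda>_. 0) has_derivative D) (at (?l 0) within ?l ` {0..1})" by simp
  moreover have "(?l has_derivative (\<lambda>h. h *\<^sub>R (y - x))) (at 0 within {0..1})"
    by (auto intro!: derivative_eq_intros)
  ultimately have "((\<lambda>_. 0) has_derivative (\<lambda>h. D (h *\<^sub>R (y - x)))) (at (0::real) within {0..1})"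
    using diff_chain_within[of ?l "\<lambda>h. h *\<^sub>R (y - x)" 0 "{0..1}" "\<lambda>_. 0" D] by (simp add: o_def)
  moreover have "D (h *\<^sub>R (y - x)) = h *\<^sub>R D (y - x)" for h
    using has_derivative_bounded_linear[OF D] by (simp add: bounded_linear.linear linear_cmul)
  ultimately have "((\<lambda>_. 0) has_vector_derivative D (y - x)) (at (0::real) within {0..1})"
    unfolding has_vector_derivative_def by simp
  then show ?thesis
    using vector_derivative_within_closed_interval[of 0 1 0 "\<lambda>_. 0 :: complex"]
      has_vector_derivative_const by (metis atLeastAtMost_iff order_refl zero_less_one zero_le_one)
qed

lemma convex_triangle: "convex (triangle T)"
proof (rule convexI)
  fix x y :: "real \<times> real" and u v :: real
  assume *: "x \<in> triangle T" "y \<in> triangle T" "0 \<le> u" "0 \<le> v" "u + v = 1"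
  obtain a b c d where xy: "x = (a, b)" "y = (c, d)" by fastforce
  have "u * b \<le> u * a" "v * d \<le> v * c" "0 \<le> u * b" "0 \<le> v * d"
    using * xy by (auto simp: triangle_def intro: mult_left_mono)
  moreover have "u * a + v * c \<le> T"
    using * xy by (intro convex_bound_le) (auto simp: triangle_def)
  ultimately show "u *\<^sub>R x + v *\<^sub>R y \<in> triangle T"
    unfolding xy triangle_def by simp
qed

text \<open>Near a corner the coordinate directions may leave the triangle, but every derivative vanishes
  towards each of the three vertices, and differences of vertices span the plane.\<close>
lemma frechet_derivative_zero_triangle:
  assumes "T > 0" "x \<in> triangle T"
  shows "frechet_derivative (\<lambda>_. 0 :: complex) (at x within triangle T) v = 0"
proof -
  let ?D = "frechet_derivative (\<lambda>_. 0 :: complex) (at x within triangle T)"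
  have D: "((\<lambda>_. 0) has_derivative ?D) (at x within triangle T)"
    unfolding frechet_derivative_works[symmetric] by simp
  interpret linear ?D
    using has_derivative_bounded_linear[OF D] by (rule bounded_linear.linear)
  have towards: "?D y = ?D x" if "y \<in> triangle T" for y
    using derivative_of_zero_towards[OF D convex_triangle assms(2) that] by (simp add: diff)
  have "?D 0 = ?D x" "?D (T, 0) = ?D x" "?D (T, T) = ?D x"
    by (rule towards, use assms(1) in \<open>simp add: triangle_def zero_prod_def\<close>)+
  then have "?D (T, 0) = 0" "?D (T, T) = 0" by (simp_all add: zero)
  moreover have "v = ((fst v - snd v) / T) *\<^sub>R (T, 0) + (snd v / T) *\<^sub>R (T, T)"
    using assms(1) by (simp add: prod_eq_iff field_simps)
  then have "?D v = ((fst v - snd v) / T) *\<^sub>R ?D (T, 0) + (snd v / T) *\<^sub>R ?D (T, T)"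
    by (metis add scale)
  ultimately show ?thesis by simp
qed

lemma flat_kernel_zero:
  assumes "T > 0"
  shows "flat_kernel T (\<lambda>_. 0)"
proof -
  have "Ck_on k (triangle T) (\<lambda>_. 0 :: complex)" for k
  proof (induction k)
    case (Suc k)
    then show ?case
      using frechet_derivative_zero_triangle[OF assms] by (auto intro: Ck_on_cong[OF Suc.IH])
  qed simp
  moreover have "iter_deriv {0..t} n (\<lambda>_. 0) 0 = 0" if "t > 0" for t n
    using deriv_seq_iter_deriv[of 0 t "\<lambda>_ _. 0" 0 n] that by (simp add: deriv_seq_def)
  ultimately show ?thesis
    unfolding flat_kernel_def smooth_on_def diagonal_flat_def by simp
qed

section \<open>Coefficients of a reordering identity\<close>

text \<open>At a fixed $t$ the identity is a convolution identity for
  $e(u) = a(t-u) - K(t, t-u)$, and flatness of $K$ makes the derivatives of $e$ at 0 those of $a$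
  alone, up to sign.\<close>
lemma reordering_coefficients:
  assumes T: "T > 0" and a: "smooth_on {0..T} a" and F: "finite F" and K: "flat_kernel T K"
    and t: "0 < t" "t \<le> T"
    and id: "\<And>f. f \<in> flat_at_zero T \<Longrightarrow>
      frac_int 1 (\<lambda>s. a s * f s) t = (\<Sum>\<gamma>\<in>F. \<beta> \<gamma> * frac_op T \<gamma> f t) + volterra K f t"
  shows "\<gamma> \<in> F \<Longrightarrow> \<not> (\<gamma> \<in> \<int> \<and> \<gamma> < 0) \<Longrightarrow> \<beta> \<gamma> = 0"
    and "(-1) ^ j * iter_deriv {0..T} j a t = (if - real (Suc j) \<in> F then \<beta> (- real (Suc j)) else 0)"
proof -
  have K': "smooth_on (triangle T) K" "\<And>n. iter_deriv {0..t} n (\<lambda>u. K (t, t - u)) 0 = 0"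
    using K t unfolding flat_kernel_def diagonal_flat_def by auto
  define e where "e = (\<lambda>k u. (-1) ^ k * iter_deriv {0..T} k a (t - u) -
      iter_deriv {0..t} k (\<lambda>u. K (t, t - u)) u)"
  have e: "deriv_seq {0..t} e"
    unfolding e_def
    using deriv_seq_subset[OF smooth_on_deriv_seq[OF a T], of "{0..t}"] t
    by (intro deriv_seq_diff deriv_seq_reflect smooth_on_deriv_seq smooth_kernel_slice[OF K'(1)]) auto
  have "integral {0..t} (\<lambda>s. e 0 (t - s) * f s) = (\<Sum>\<gamma>\<in>F. \<beta> \<gamma> * frac_op T \<gamma> f t)"
    if f: "f \<in> flat_at_zero T" for f
  proof -
    have sub: "{0..t} \<subseteq> {0..T}" using t by auto
    have cf: "continuous_on {0..t} f" and ca: "continuous_on {0..t} a"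
      using f continuous_on_subset[OF smooth_on_imp_continuous_on sub] a
      unfolding flat_at_zero_def by blast+
    have cK: "continuous_on {0..t} (\<lambda>s. K (t, s))"
      by (rule continuous_on_compose2[OF smooth_on_imp_continuous_on[OF K'(1)]])
        (use t in \<open>auto intro!: continuous_intros simp: triangle_def\<close>)
    have "integral {0..t} (\<lambda>s. e 0 (t - s) * f s) = integral {0..t} (\<lambda>s. a s * f s - K (t, s) * f s)"
      unfolding e_def by (simp add: left_diff_distrib)
    also have "\<dots> = integral {0..t} (\<lambda>s. a s * f s) - volterra K f t"
      unfolding volterra_def
      by (intro integral_diff integrable_continuous_interval continuous_intros cf ca cK)
    also have "integral {0..t} (\<lambda>s. a s * f s) = frac_int 1 (\<lambda>s. a s * f s) t"
      using frac_int_nat[of 0 "\<lambda>s. a s * f s" t] by simp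
    finally show ?thesis using id[OF f] by simp
  qed
  note coeff = coefficients_of_convolution[OF t e F this]
  show "\<gamma> \<in> F \<Longrightarrow> \<not> (\<gamma> \<in> \<int> \<and> \<gamma> < 0) \<Longrightarrow> \<beta> \<gamma> = 0"
    by (rule coeff(1))
  show "(-1) ^ j * iter_deriv {0..T} j a t = (if - real (Suc j) \<in> F then \<beta> (- real (Suc j)) else 0)"
    using coeff(2)[of j] K'(2)[of j] unfolding e_def by simp
qed

lemma eq_at_left_endpoint:
  fixes f g :: "real \<Rightarrow> complex"
  assumes "T > 0" "continuous_on {0..T} f" "continuous_on {0..T} g"
    and "\<And>t. t \<in> {0<..T} \<Longrightarrow> f t = g t" and "t \<in> {0..T}"
  shows "f t = g t"
proof -
  have cl: "closure {0<..T} = {0..T}" using assms(1) by (rule closure_greaterThanAtMost)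
  have "continuous_on (closure {0<..T}) (\<lambda>t. f t - g t)"
    unfolding cl by (intro continuous_on_diff assms)
  moreover have "t \<in> closure {0<..T}" using assms(5) unfolding cl .
  ultimately have "f t - g t = 0"
    using continuous_constant_on_closure[of "{0<..T}" "\<lambda>t. f t - g t" 0 t] assms(4) by simp
  then show ?thesis by simp
qed

text \<open>The operators $J^{j+1}$ are the operators $D^\gamma$ with $\gamma = -(j+1)$, so this is the
  general result for $t > 0$; continuity of both sides covers $t = 0$, where the identity itself
  carries no information.\<close>
lemma reorder_identity_coefficients:
  assumes T: "T > 0" and a: "smooth_on {0..T} a" and b: "\<And>j. j \<le> N \<Longrightarrow> smooth_on {0..T} (b j)"
    and K: "flat_kernel T K" and id: "reorder_identity T a N b K" and t: "t \<in> {0..T}"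
  shows "(-1) ^ j * iter_deriv {0..T} j a t = (if j \<le> N then b j t else 0)"
proof (rule eq_at_left_endpoint[OF T _ _ _ t])
  show "continuous_on {0..T} (\<lambda>t. (-1) ^ j * iter_deriv {0..T} j a t)"
    by (intro continuous_intros smooth_on_imp_continuous_on smooth_on_iter_deriv a T)
  show "continuous_on {0..T} (\<lambda>t. if j \<le> N then b j t else 0)"
    using smooth_on_imp_continuous_on[OF b[of j]] by (cases "j \<le> N") auto
  fix t assume t: "t \<in> {0<..T}"
  define F where "F = (\<lambda>j. - real (Suc j)) ` {0..N}"
  define \<beta> where "\<beta> \<gamma> = b (nat \<lfloor>- \<gamma>\<rfloor> - 1) t" for \<gamma> :: real
  have \<beta>: "\<beta> (- real (Suc j)) = b j t" for j
  proof -
    have "nat \<lfloor>- (- real (Suc j))\<rfloor> - 1 = j"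
      by (metis diff_Suc_1 floor_of_nat minus_minus nat_int)
    then show ?thesis unfolding \<beta>_def by simp
  qed
  have "frac_int 1 (\<lambda>s. a s * f s) t = (\<Sum>\<gamma>\<in>F. \<beta> \<gamma> * frac_op T \<gamma> f t) + volterra K f t"
    if "f \<in> flat_at_zero T" for f
  proof -
    have "(\<Sum>\<gamma>\<in>F. \<beta> \<gamma> * frac_op T \<gamma> f t) =
        (\<Sum>j=0..N. \<beta> (- real (Suc j)) * frac_op T (- real (Suc j)) f t)"
      unfolding F_def by (subst sum.reindex) (auto simp: inj_on_def)
    also have "\<dots> = (\<Sum>j=0..N. b j t * frac_int (real (j + 1)) f t)"
      unfolding \<beta> by (simp add: frac_op_def add.commute)
    finally show ?thesis
      using id that t unfolding reorder_identity_def by auto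
  qed
  from reordering_coefficients(2)[OF T a _ K _ _ this, of j] t
  have "(-1) ^ j * iter_deriv {0..T} j a t = (if - real (Suc j) \<in> F then b j t else 0)"
    unfolding \<beta> by (simp add: F_def)
  moreover have "- real (Suc j) \<in> F \<longleftrightarrow> j \<le> N" unfolding F_def by auto
  ultimately show "(-1) ^ j * iter_deriv {0..T} j a t = (if j \<le> N then b j t else 0)" by simp
qed

section \<open>Polynomial multipliers\<close>

lemma deriv_seq_poly: "deriv_seq S (\<lambda>k s. poly ((pderiv ^^ k) p) (of_real s))"
  unfolding deriv_seq_def by (auto intro!: has_vector_derivative_real_field poly_DERIV)

lemma higher_pderiv_eq_0:
  fixes p :: "complex poly"
  assumes "degree p \<le> n"
  shows "(pderiv ^^ Suc n) p = 0"
  using assms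
proof (induction n arbitrary: p)
  case 0
  then show ?case by (simp add: pderiv_eq_0_iff)
next
  case (Suc n)
  then have "(pderiv ^^ Suc n) (pderiv p) = 0"
    by (intro Suc.IH) (simp add: degree_pderiv)
  then show ?case by (simp only: funpow_Suc_right o_def)
qed

text \<open>Insert the finite Taylor expansion of $p(s)$ around $t$ into the integral of $p f$; the powers
  $(t-s)^j / j!$ are the kernels of $J^{j+1}$.\<close>
lemma poly_reorder_identity:
  fixes p :: "complex poly"
  assumes "T > 0"
  obtains b where "\<And>j. smooth_on {0..T} (b j)"
    "reorder_identity T (\<lambda>t. poly p (of_real t)) (degree p) b (\<lambda>_. 0)"
proof
  define N where "N = degree p"
  define D where "D j t = poly ((pderiv ^^ j) p) (complex_of_real t)" for j t
  let ?b = "\<lambda>j t. poly (smult ((-1) ^ j) ((pderiv ^^ j) p)) (complex_of_real t)"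
  show "smooth_on {0..T} (?b j)" for j
    using deriv_seq_smooth_on[OF assms,
        OF deriv_seq_poly[where p = "smult ((-1) ^ j) ((pderiv ^^ j) p)"], of 0] by simp
  show "reorder_identity T (\<lambda>t. poly p (of_real t)) (degree p) ?b (\<lambda>_. 0)"
    unfolding reorder_identity_def
  proof (intro ballI)
    fix f t assume f: "f \<in> flat_at_zero T" and t: "t \<in> {0..T}"
    have cf: "continuous_on {0..t} f"
      using f t continuous_on_subset[OF smooth_on_imp_continuous_on, of "{0..T}" f "{0..t}"]
      unfolding flat_at_zero_def by auto
    have seq: "deriv_seq {0..t} (\<lambda>k u. (-1) ^ k * D k (t - u))"
      unfolding D_def by (intro deriv_seq_reflect deriv_seq_poly)
    have taylor: "poly p (of_real s) = (\<Sum>j<Suc N. (-1) ^ j * D j t * complex_of_real ((t - s) ^ j / fact j))"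
      if "s \<in> {0..t}" for s
    proof -
      have "D (Suc N) x = 0" for x
        using higher_pderiv_eq_0[of p N] unfolding D_def N_def by simp
      then have "(-1) ^ 0 * D 0 (t - (t - s)) = (\<Sum>j<Suc N. complex_of_real ((t - s) ^ j / fact j) *
          ((-1) ^ j * D j (t - 0)))"
        using that by (intro deriv_seq_taylor_exact[OF seq]) auto
      then show ?thesis by (simp add: D_def mult_ac del: sum.lessThan_Suc)
    qed
    have "frac_int 1 (\<lambda>s. poly p (of_real s) * f s) t = integral {0..t} (\<lambda>s. poly p (of_real s) * f s)"
      using frac_int_nat[of 0 "\<lambda>s. poly p (of_real s) * f s" t] by simp
    also have "\<dots> = integral {0..t} (\<lambda>s. \<Sum>j<Suc N. (-1) ^ j * D j t *
        (complex_of_real ((t - s) ^ j / fact j) * f s))"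
      by (rule integral_cong) (simp only: taylor sum_distrib_right mult.assoc)
    also have "\<dots> = (\<Sum>j<Suc N. integral {0..t} (\<lambda>s. (-1) ^ j * D j t *
        (complex_of_real ((t - s) ^ j / fact j) * f s)))"
      by (intro integral_sum integrable_continuous_interval continuous_intros cf) auto
    also have "\<dots> = (\<Sum>j<Suc N. (-1) ^ j * D j t * frac_int (real (j + 1)) f t)"
      using frac_int_nat[of _ f t] by (simp del: sum.lessThan_Suc of_nat_Suc)
    also have "\<dots> = (\<Sum>j=0..degree p. ?b j t * frac_int (real (j + 1)) f t)"
      unfolding D_def N_def lessThan_Suc_atMost atMost_atLeast0 by simp
    finally show "frac_int 1 (\<lambda>s. poly p (of_real s) * f s) t =
        (\<Sum>j=0..degree p. ?b j t * frac_int (real (j + 1)) f t) + volterra (\<lambda>_. 0) f t"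
      unfolding volterra_def by simp
  qed
qed

lemma reorder_identity_cong:
  assumes "\<And>s. s \<in> {0..T} \<Longrightarrow> a s = a' s"
  shows "reorder_identity T a N b K \<longleftrightarrow> reorder_identity T a' N b K"
proof -
  have "frac_int 1 (\<lambda>s. a s * f s) t = frac_int 1 (\<lambda>s. a' s * f s) t" if "t \<in> {0..T}" for f t
    unfolding frac_int_def using assms that by (auto intro!: integral_cong)
  then show ?thesis unfolding reorder_identity_def by simp
qed

lemma smooth_on_poly_if_iter_deriv_0:
  assumes T: "T > 0" and a: "smooth_on {0..T} a"
    and 0: "\<And>t. t \<in> {0..T} \<Longrightarrow> iter_deriv {0..T} (Suc N) a t = 0"
  obtains p :: "complex poly" where "degree p \<le> N" "\<And>t. t \<in> {0..T} \<Longrightarrow> a t = poly p (of_real t)"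
proof
  let ?p = "\<Sum>k\<le>N. monom (iter_deriv {0..T} k a 0 / fact k) k"
  show "degree ?p \<le> N"
    by (intro degree_sum_le) (auto intro: order_trans[OF degree_monom_le])
  show "a t = poly ?p (of_real t)" if "t \<in> {0..T}" for t
    using deriv_seq_taylor_exact[OF smooth_on_deriv_seq[OF a T], of "Suc N" t] 0 that
    by (simp add: poly_sum poly_monom lessThan_Suc_atMost mult_ac)
qed

section \<open>The multipliers that reorder finitely\<close>

theorem mainTheorem5:
  fixes T :: real and a :: "real \<Rightarrow> complex"
  assumes "T > 0" and "smooth_on {0..T} a"
  shows
    "(\<forall>(F :: real set) (b :: real \<Rightarrow> real \<Rightarrow> complex) (K :: real \<times> real \<Rightarrow> complex).
       finite F \<and> (\<forall>\<gamma>\<in>F. smooth_on {0..T} (b \<gamma>)) \<and> flat_kernel T K \<and>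
       (\<forall>f\<in>flat_at_zero T. \<forall>t\<in>{0..T}.
          frac_int 1 (\<lambda>s. a s * f s) t = (\<Sum>\<gamma>\<in>F. b \<gamma> t * frac_op T \<gamma> f t) + volterra K f t)
       \<longrightarrow> (\<forall>\<gamma>\<in>F. \<not> (\<gamma> \<in> \<int> \<and> \<gamma> < 0) \<longrightarrow> (\<forall>t\<in>{0..T}. b \<gamma> t = 0)))
     \<and>
     (\<forall>(N :: nat) (b :: nat \<Rightarrow> real \<Rightarrow> complex) (K :: real \<times> real \<Rightarrow> complex).
       (\<forall>j\<le>N. smooth_on {0..T} (b j)) \<and> flat_kernel T K \<and> reorder_identity T a N b K
       \<longrightarrow> (\<forall>j\<le>N. \<forall>t\<in>{0..T}. b j t = (-1) ^ j * iter_deriv {0..T} j a t) \<and>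
           (\<forall>j>N. \<forall>t\<in>{0..T}. iter_deriv {0..T} j a t = 0) \<and>
           (\<exists>p :: complex poly. degree p \<le> N \<and> (\<forall>t\<in>{0..T}. a t = poly p (of_real t))))
     \<and>
     (\<forall>p :: complex poly. \<exists>(N :: nat) (b :: nat \<Rightarrow> real \<Rightarrow> complex).
       (\<forall>j\<le>N. smooth_on {0..T} (b j)) \<and>
       reorder_identity T (\<lambda>t. poly p (of_real t)) N b (\<lambda>_. 0))
     \<and>
     (finitely_reorders T a \<longleftrightarrow>
       (\<exists>p :: complex poly. \<forall>t\<in>{0..T}. a t = poly p (of_real t)))"
    (is "?negative_integers_only \<and> ?taylor_coefficients \<and> ?polynomials_reorder \<and> ?characterization")
proof -
  have neg: ?negative_integers_only
  proof (intro allI impI ballI)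
    fix F :: "real set" and b :: "real \<Rightarrow> real \<Rightarrow> complex" and K \<gamma> t
    assume *: "finite F \<and> (\<forall>\<gamma>\<in>F. smooth_on {0..T} (b \<gamma>)) \<and> flat_kernel T K \<and>
       (\<forall>f\<in>flat_at_zero T. \<forall>t\<in>{0..T}.
          frac_int 1 (\<lambda>s. a s * f s) t = (\<Sum>\<gamma>\<in>F. b \<gamma> t * frac_op T \<gamma> f t) + volterra K f t)"
      and \<gamma>: "\<gamma> \<in> F" "\<not> (\<gamma> \<in> \<int> \<and> \<gamma> < 0)" and t: "t \<in> {0..T}"
    show "b \<gamma> t = 0"
    proof (rule eq_at_left_endpoint[OF \<open>T > 0\<close> _ _ _ t])
      show "continuous_on {0..T} (b \<gamma>)"
        using * \<gamma> smooth_on_imp_continuous_on by blast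
      show "b \<gamma> s = 0" if "s \<in> {0<..T}" for s
      proof (rule reordering_coefficients(1)[where \<beta> = "\<lambda>\<gamma>. b \<gamma> s", OF assms _ _ _ _ _ \<gamma>])
        show "finite F" "flat_kernel T K" "0 < s" "s \<le> T" using * that by auto
        show "frac_int 1 (\<lambda>s. a s * f s) s = (\<Sum>\<gamma>\<in>F. b \<gamma> s * frac_op T \<gamma> f s) + volterra K f s"
          if "f \<in> flat_at_zero T" for f
          using * that \<open>s \<in> {0<..T}\<close> by auto
      qed
    qed simp
  qed
  have taylor: ?taylor_coefficients
  proof (intro allI impI, elim conjE)
    fix N and b :: "nat \<Rightarrow> real \<Rightarrow> complex" and K
    assume *: "\<forall>j\<le>N. smooth_on {0..T} (b j)" "flat_kernel T K" "reorder_identity T a N b K"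
    have coeff: "(-1) ^ j * iter_deriv {0..T} j a t = (if j \<le> N then b j t else 0)"
      if "t \<in> {0..T}" for j t
      using * by (intro reorder_identity_coefficients[OF assms _ *(2,3) that]) blast
    have "iter_deriv {0..T} j a t = 0" if "j > N" "t \<in> {0..T}" for j t
      using coeff[OF that(2), of j] that(1) by simp
    then show "(\<forall>j\<le>N. \<forall>t\<in>{0..T}. b j t = (-1) ^ j * iter_deriv {0..T} j a t) \<and>
           (\<forall>j>N. \<forall>t\<in>{0..T}. iter_deriv {0..T} j a t = 0) \<and>
           (\<exists>p :: complex poly. degree p \<le> N \<and> (\<forall>t\<in>{0..T}. a t = poly p (of_real t)))"
      using coeff smooth_on_poly_if_iter_deriv_0[OF assms, of N] by (metis lessI)
  qed
  have poly: ?polynomials_reorder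
    using poly_reorder_identity[OF \<open>T > 0\<close>] by metis
  have "finitely_reorders T a" if "\<forall>t\<in>{0..T}. a t = poly p (of_real t)" for p :: "complex poly"
  proof -
    obtain N b where "\<forall>j\<le>N. smooth_on {0..T} (b j)"
      "reorder_identity T (\<lambda>t. poly p (of_real t)) N b (\<lambda>_. 0)"
      using poly by blast
    moreover from this have "reorder_identity T a N b (\<lambda>_. 0)"
      using that reorder_identity_cong[of T a "\<lambda>t. poly p (of_real t)"] by blast
    ultimately show ?thesis
      unfolding finitely_reorders_def using flat_kernel_zero[OF \<open>T > 0\<close>] by blast
  qed
  moreover have "\<exists>p :: complex poly. \<forall>t\<in>{0..T}. a t = poly p (of_real t)" if "finitely_reorders T a"
    using that taylor unfolding finitely_reorders_def by blast
  ultimately have ?characterization by blast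
  with neg taylor poly show ?thesis by blast
qed

end
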